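(* Let $G$ be a finite $2$-Frobenius group, with normal subgroups $K$ and $L$ of $G$ such that $L$ is a Frobenius group with Frobenius kernel $K$ and $G/K$ is a Frobenius group with Frobenius kernel $L/K$. Assume that $K$ and $G/L$ are both $p$-groups for some prime $p$. Then the cyclic graph $\Delta(G)$ has exactly $|K|+m_{p}(G)$ connected components, where $m_p(G)$ denotes the number of subgroups of order $p$ of $G$.
   Context: All groups are finite. A group $G$ is a $2$-Frobenius group if it has normal subgroups $K$ and $L$ such that $L$ is a Frobenius group with Frobenius kernel $K$ and $G/K$ is a Frobenius group with Frobenius kernel $L/K$. The cyclic graph $\Delta(G)$ of a group $G$ is the graph whose vertex set is $G\setminus\{1\}$, with an edge between distinct vertices $x$ and $y$ if and only if the subgroup $\langle x,y\rangle$ is cyclic. *)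

theory Defs
  imports "HOL-Algebra.Algebra" "Graph_Theory.Graph_Theory"
begin

section \<open>Frobenius and 2-Frobenius groups\<close>

definition frobenius_complement :: "('a, 'b) monoid_scheme \<Rightarrow> 'a set \<Rightarrow> bool" where
  "frobenius_complement G H \<longleftrightarrow>
     group G \<and> subgroup H G \<and> H \<noteq> {\<one>\<^bsub>G\<^esub>} \<and> H \<noteq> carrier G \<and>
     (\<forall>g \<in> carrier G - H. H \<inter> (g <#\<^bsub>G\<^esub> (H #>\<^bsub>G\<^esub> inv\<^bsub>G\<^esub> g)) = {\<one>\<^bsub>G\<^esub>})"

text \<open>
  The kernel consists of the identity and the elements lying in no conjugate of the complement.
\<close>

definition frobenius_kernel :: "('a, 'b) monoid_scheme \<Rightarrow> 'a set \<Rightarrow> 'a set" where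
  "frobenius_kernel G H =
     (carrier G - (\<Union>g \<in> carrier G. g <#\<^bsub>G\<^esub> (H #>\<^bsub>G\<^esub> inv\<^bsub>G\<^esub> g))) \<union> {\<one>\<^bsub>G\<^esub>}"

definition frobenius_group_with_kernel :: "('a, 'b) monoid_scheme \<Rightarrow> 'a set \<Rightarrow> bool" where
  "frobenius_group_with_kernel G K \<longleftrightarrow>
     (\<exists>H. frobenius_complement G H \<and> K = frobenius_kernel G H)"

text \<open>
  The subgroup \<open>L / K\<close> of \<open>G / K\<close> is the set of cosets of \<open>K\<close> in \<open>L\<close>.
\<close>

definition two_frobenius_group :: "('a, 'b) monoid_scheme \<Rightarrow> 'a set \<Rightarrow> 'a set \<Rightarrow> bool" where
  "two_frobenius_group G K L \<longleftrightarrow>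
     K \<lhd> G \<and> L \<lhd> G \<and>
     frobenius_group_with_kernel (G\<lparr>carrier := L\<rparr>) K \<and>
     frobenius_group_with_kernel (G Mod K) (carrier (G\<lparr>carrier := L\<rparr> Mod K))"

section \<open>Finite p-groups and subgroups of order p\<close>

definition p_group :: "nat \<Rightarrow> ('a, 'b) monoid_scheme \<Rightarrow> bool" where
  "p_group p G \<longleftrightarrow> group G \<and> (\<exists>n. order G = p ^ n)"

definition num_subgroups_of_order :: "nat \<Rightarrow> ('a, 'b) monoid_scheme \<Rightarrow> nat" where
  "num_subgroups_of_order p G = card {P. subgroup P G \<and> card P = p}"

section \<open>The cyclic graph\<close>

text \<open>
  An undirected graph is represented by a digraph with a symmetric arc relation.
\<close>

definition cyclic_graph :: "('a, 'b) monoid_scheme \<Rightarrow> 'a pair_pre_digraph" where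
  "cyclic_graph G = \<lparr>
     pverts = carrier G - {\<one>\<^bsub>G\<^esub>},
     parcs = {(x, y). x \<in> carrier G - {\<one>\<^bsub>G\<^esub>} \<and> y \<in> carrier G - {\<one>\<^bsub>G\<^esub>} \<and> x \<noteq> y \<and>
                      cyclic_group (subgroup_generated G {x, y})} \<rparr>"

lemma pair_graph_cyclic_graph:
  assumes "finite (carrier G)"
  shows "pair_graph (cyclic_graph G)"
proof
  have "parcs (cyclic_graph G) \<subseteq> carrier G \<times> carrier G"
    by (auto simp: cyclic_graph_def)
  then show "finite (parcs (cyclic_graph G))"
    using assms finite_subset by blast
  show "symmetric (cyclic_graph G)"
    by (auto simp: symmetric_def sym_def cyclic_graph_def insert_commute)
qed (use assms in \<open>auto simp: cyclic_graph_def\<close>)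

text \<open>
  \<^const>\<open>connected\<close> ignores the orientation of arcs and requires a nonempty vertex set, so the
  components are the maximal connected subgraphs in the undirected sense.
\<close>

definition connected_components :: "('a, 'b) pre_digraph \<Rightarrow> ('a, 'b) pre_digraph set" where
  "connected_components D = {C. pre_digraph.max_subgraph D connected C}"

end

theory Submission
  imports Defs
begin

text \<open>
  Let \<open>H\<close> be a Frobenius complement of \<open>K\<close> in \<open>L\<close>. Elements outside \<open>L\<close> are \<open>p\<close>-elements, because a
  complement of \<open>L / K\<close> in \<open>G / K\<close> embeds into the \<open>p\<close>-group \<open>G / L\<close>; so every element of \<open>G\<close> is a
  \<open>p\<close>-element or lies in one of the \<open>|K|\<close> conjugates of \<open>H\<close>. Two \<open>p\<close>-elements are connected iff they
  have the same subgroup of order \<open>p\<close> below them, and each conjugate of \<open>H\<close> gives one component once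
  \<open>H\<close> is known to be cyclic.

  Cyclicity of \<open>H\<close> is the heart of the matter, and the proof below avoids Thompson's theorem. Acting
  freely on \<open>K\<close>, the group \<open>H\<close> contains no \<open>C\<^sub>r \<times> C\<^sub>r\<close>; and \<open>H\<close>, being isomorphic to \<open>L / K\<close>, admits a
  fixed-point-free automorphism \<open>\<alpha>\<close>. Any finite group with these two properties is cyclic, by
  induction on the order. The map \<open>x \<mapsto> x\<^sup>-\<^sup>1 \<alpha> x\<close> is bijective, so (as in Lang's theorem) every
  element of prime order has a conjugate \<open>y\<close> with \<open>\<alpha> y \<in> \<langle>y\<rangle>\<close>. If no such \<open>y\<close> is central, the
  centralizers of these \<open>y\<close> are cyclic Frobenius complements; they form at least two conjugacy
  classes, whose members meet pairwise trivially, and counting elements gives a contradiction. If some such \<open>y\<close> is central, one passes to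
  the quotient by the subgroup of prime order \<open>q\<close> in some \<open>\<langle>y\<rangle>\<close>, where \<open>q\<close> is odd by freeness of \<open>\<alpha>\<close>.
\<close>

section \<open>Actions of finite p-groups\<close>

text \<open>The maps in \<open>Bij E\<close> are extensional, undefined off \<open>E\<close>, so a
  raw action \<open>f\<close> has to be cut down to \<open>E\<close> before orbits and stabilizers
  are available; invertibility comes from the action of \<open>inv g\<close>.\<close>

lemma group_action_restrictI:
  assumes "group G"
    and closed: "\<And>g x. g \<in> carrier G \<Longrightarrow> x \<in> E \<Longrightarrow> f g x \<in> E"
    and one: "\<And>x. x \<in> E \<Longrightarrow> f \<one>\<^bsub>G\<^esub> x = x"
    and mult: "\<And>g h x. g \<in> carrier G \<Longrightarrow> h \<in> carrier G \<Longrightarrow> x \<in> E \<Longrightarrow> f (g \<otimes>\<^bsub>G\<^esub> h) x = f g (f h x)"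
  shows "group_action G E (\<lambda>g. \<lambda>x\<in>E. f g x)"
proof -
  interpret group G by fact
  have bij: "(\<lambda>x\<in>E. f g x) \<in> Bij E" if g: "g \<in> carrier G" for g
  proof -
    have "f (inv\<^bsub>G\<^esub> g) (f g x) = x" "f g (f (inv\<^bsub>G\<^esub> g) x) = x" if "x \<in> E" for x
      using that g mult[of "inv\<^bsub>G\<^esub> g" g x] mult[of g "inv\<^bsub>G\<^esub> g" x] one by simp_all
    then have "bij_betw (f g) E E"
      using g closed by (intro bij_betw_byWitness[where f' = "f (inv\<^bsub>G\<^esub> g)"]) auto
    then show ?thesis
      by (simp add: Bij_def cong: bij_betw_cong)
  qed
  have "(\<lambda>g. \<lambda>x\<in>E. f g x) \<in> hom G (BijGroup E)"
  proof (rule homI)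
    fix g h assume "g \<in> carrier G" "h \<in> carrier G"
    then show "(\<lambda>x\<in>E. f (g \<otimes>\<^bsub>G\<^esub> h) x) = (\<lambda>x\<in>E. f g x) \<otimes>\<^bsub>BijGroup E\<^esub> (\<lambda>x\<in>E. f h x)"
      using bij closed mult by (auto simp: BijGroup_def compose_def fun_eq_iff)
  qed (use bij in \<open>simp add: BijGroup_def\<close>)
  then show ?thesis
    by (simp add: group_action_def group_hom_def group_hom_axioms_def group_BijGroup assms(1))
qed

text \<open>By orbit-stabilizer the size of each orbit is a power of \<open>p\<close>. An orbit
  without fixed points is not a singleton, so its size is divisible by \<open>p\<close>; an orbit
  containing a fixed point is that point alone.\<close>

lemma p_group_card_fixed_points:
  assumes "group G" "Factorial_Ring.prime p" "order G = p ^ n" "finite E"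
    and closed: "\<And>g x. g \<in> carrier G \<Longrightarrow> x \<in> E \<Longrightarrow> f g x \<in> E"
    and one: "\<And>x. x \<in> E \<Longrightarrow> f \<one>\<^bsub>G\<^esub> x = x"
    and mult: "\<And>g h x. g \<in> carrier G \<Longrightarrow> h \<in> carrier G \<Longrightarrow> x \<in> E \<Longrightarrow> f (g \<otimes>\<^bsub>G\<^esub> h) x = f g (f h x)"
  shows "card {x \<in> E. \<forall>g\<in>carrier G. f g x = x} mod p = card E mod p"
proof -
  let ?\<phi> = "\<lambda>g. \<lambda>x\<in>E. f g x"
  interpret group_action G E ?\<phi>
    by (rule group_action_restrictI) fact+
  let ?F = "{x \<in> E. \<forall>g\<in>carrier G. f g x = x}"
  let ?O = "orbits G E ?\<phi>"
  have finO: "finite ?O"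
    using assms(4) by (simp add: orbits_def)
  have sub: "B \<subseteq> E" if "B \<in> ?O" for B
    using that orbits_coverture by blast
  have orb: "Group_Action.orbit G ?\<phi> x = {f g x |g. g \<in> carrier G}" if "x \<in> E" for x
    using that by (auto simp: Group_Action.orbit_def)
  have mod1: "card B mod p = card (B \<inter> ?F) mod p" if B: "B \<in> ?O" for B
  proof -
    obtain x where x: "x \<in> E" "B = Group_Action.orbit G ?\<phi> x"
      using B by (auto simp: orbits_def)
    have xX: "x \<in> B"
      using orbit_refl x by blast
    show ?thesis
    proof (cases "B \<inter> ?F = {}")
      case True
      have "card B dvd p ^ n"
        using orbit_stabilizer_theorem[OF x(1)] assms(3) x(2) by (metis dvd_triv_left)
      then obtain k where k: "card B = p ^ k"
        using assms(2) by (auto simp: divides_primepow_nat)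
      have "k \<noteq> 0"
      proof
        assume "k = 0"
        then obtain z where "B = {z}"
          using k by (auto simp: card_1_singleton_iff)
        then have "x \<in> ?F"
          using x xX orb[OF x(1)] by auto
        then show False using True xX by blast
      qed
      then show ?thesis using True k by simp
    next
      case False
      then obtain z where z: "z \<in> B" "z \<in> ?F" by blast
      then have "x \<in> Group_Action.orbit G ?\<phi> z"
        using orbit_sym x sub[OF B] by blast
      then have "x = z"
        using z(2) orb by auto
      then have "B = {z}"
        using z x orb by auto
      then show ?thesis using z by auto
    qed
  qed
  have disj: "B \<inter> C = {}" if "B \<in> ?O" "C \<in> ?O" "B \<noteq> C" for B C
    using disjoint_union that by blast
  have "card E = card (\<Union>?O)"
    using orbits_coverture by simp
  also have "\<dots> = (\<Sum>B\<in>?O. card B)"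
    using disj finite_subset[OF sub assms(4)] by (intro card_Union_disjoint) (auto simp: pairwise_def disjnt_def)
  finally have 1: "card E = (\<Sum>B\<in>?O. card B)" .
  have "?F = (\<Union>B\<in>?O. B \<inter> ?F)"
    using orbits_coverture by blast
  also have "card \<dots> = (\<Sum>B\<in>?O. card (B \<inter> ?F))"
    using finO disj sub assms(4) by (intro card_UN_disjoint) (auto intro: finite_subset)
  finally have 2: "card ?F = (\<Sum>B\<in>?O. card (B \<inter> ?F))" .
  have "(\<Sum>B\<in>?O. card B) mod p = (\<Sum>B\<in>?O. card (B \<inter> ?F)) mod p"
    using mod1 by (subst (1 2) mod_sum_eq[symmetric]) (simp cong: sum.cong)
  then show ?thesis
    using 1 2 by simp
qed

section \<open>Conjugation, and fixed points of p-elements\<close>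

context group
begin

lemma mem_conj_set_iff:
  assumes "H \<subseteq> carrier G" "g \<in> carrier G"
  shows "x \<in> g <# (H #> inv g) \<longleftrightarrow> x \<in> carrier G \<and> inv g \<otimes> x \<otimes> g \<in> H"
proof -
  have "x \<in> g <# (H #> inv g) \<longleftrightarrow> (\<exists>h\<in>H. x = g \<otimes> (h \<otimes> inv g))"
    by (auto simp: l_coset_def r_coset_def)
  also have "\<dots> \<longleftrightarrow> x \<in> carrier G \<and> inv g \<otimes> x \<otimes> g \<in> H"
  proof safe
    fix h assume h: "h \<in> H"
    then have hc: "h \<in> carrier G" using assms by blast
    then show "g \<otimes> (h \<otimes> inv g) \<in> carrier G" using assms by simp
    have "inv g \<otimes> (g \<otimes> (h \<otimes> inv g)) \<otimes> g = h"
      using hc assms by (simp add: m_assoc flip: m_assoc[of "inv g" g])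
    then show "inv g \<otimes> (g \<otimes> (h \<otimes> inv g)) \<otimes> g \<in> H"
      using h by simp
  next
    assume "x \<in> carrier G" "inv g \<otimes> x \<otimes> g \<in> H"
    moreover have "x = g \<otimes> ((inv g \<otimes> x \<otimes> g) \<otimes> inv g)"
      using assms \<open>x \<in> carrier G\<close> by (simp add: m_assoc flip: m_assoc[of g "inv g"])
    ultimately show "\<exists>h\<in>H. x = g \<otimes> (h \<otimes> inv g)" by blast
  qed
  finally show ?thesis .
qed

lemma conj_mult:
  assumes "g \<in> carrier G" "x \<in> carrier G" "y \<in> carrier G"
  shows "g \<otimes> (x \<otimes> y) \<otimes> inv g = (g \<otimes> x \<otimes> inv g) \<otimes> (g \<otimes> y \<otimes> inv g)"
proof -
  have "inv g \<otimes> (g \<otimes> (y \<otimes> inv g)) = y \<otimes> inv g"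
    using assms by (metis inv_closed inv_solve_left m_closed)
  then show ?thesis
    using assms by (simp add: m_assoc)
qed

lemma conj_inv:
  assumes "g \<in> carrier G" "x \<in> carrier G"
  shows "inv (g \<otimes> x \<otimes> inv g) = g \<otimes> inv x \<otimes> inv g"
proof (rule inv_equality)
  show "g \<otimes> inv x \<otimes> inv g \<otimes> (g \<otimes> x \<otimes> inv g) = \<one>"
    using assms by (simp flip: conj_mult)
qed (use assms in simp_all)

lemma conj_hom: "g \<in> carrier G \<Longrightarrow> (\<lambda>x. g \<otimes> x \<otimes> inv g) \<in> hom G G"
  by (rule homI) (simp_all add: conj_mult)

lemma conj_pow:
  fixes n :: nat
  assumes "g \<in> carrier G" "x \<in> carrier G"
  shows "(g \<otimes> x \<otimes> inv g) [^] n = g \<otimes> x [^] n \<otimes> inv g"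
  by (induction n) (use assms in \<open>simp_all add: conj_mult\<close>)

lemma conj_conj:
  assumes "g \<in> carrier G" "h \<in> carrier G" "x \<in> carrier G"
  shows "g \<otimes> (h \<otimes> x \<otimes> inv h) \<otimes> inv g = (g \<otimes> h) \<otimes> x \<otimes> inv (g \<otimes> h)"
  using assms by (simp add: m_assoc inv_mult_group)

lemma conj_inv_conj [simp]:
  assumes "g \<in> carrier G" "x \<in> carrier G"
  shows "inv g \<otimes> (g \<otimes> x \<otimes> inv g) \<otimes> g = x" "g \<otimes> (inv g \<otimes> x \<otimes> g) \<otimes> inv g = x"
  using conj_conj[of "inv g" g x] conj_conj[of g "inv g" x] assms by simp_all

lemma conj_eq_one_iff [simp]:
  assumes "g \<in> carrier G" "x \<in> carrier G"
  shows "g \<otimes> x \<otimes> inv g = \<one> \<longleftrightarrow> x = \<one>"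
  using conj_inv_conj(1)[OF assms] assms by (metis inv_closed l_inv r_one r_inv)

lemma conj_eq_iff_commute:
  assumes "g \<in> carrier G" "x \<in> carrier G"
  shows "g \<otimes> x \<otimes> inv g = x \<longleftrightarrow> g \<otimes> x = x \<otimes> g"
  using assms by (metis inv_solve_right m_closed)

lemma generate_singleton_iff:
  assumes "finite (carrier G)" "a \<in> carrier G"
  shows "x \<in> generate G {a} \<longleftrightarrow> (\<exists>k::nat. x = a [^] k)"
  using generate_pow_on_finite_carrier[OF assms] by auto

lemma subgroup_pow_closed:
  fixes n :: nat
  assumes "subgroup H G" "x \<in> H"
  shows "x [^] n \<in> H"
  by (induction n) (use assms in \<open>auto intro: subgroup.m_closed subgroup.one_closed simp: subgroup.mem_carrier\<close>)

lemma pow_carrier_update: "x [^]\<^bsub>G\<lparr>carrier := H\<rparr>\<^esub> (n::nat) = x [^] n"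
  by (simp add: nat_pow_def)

lemma exists_prime_order_pow:
  assumes "finite (carrier G)" "x \<in> carrier G" "x \<noteq> \<one>"
  shows "\<exists>(q::nat) (m::nat). Factorial_Ring.prime q \<and> x [^] m \<noteq> \<one> \<and> (x [^] m) [^] q = \<one>"
proof -
  have "ord x \<noteq> 1" "ord x > 0"
    using ord_eq_1 assms ord_ge_1[OF assms(1,2)] by auto
  then obtain q where q: "Factorial_Ring.prime q" "q dvd ord x"
    using prime_factor_nat by blast
  then obtain m where m: "ord x = q * m" by (elim dvdE)
  then have "\<not> ord x dvd m"
    using \<open>ord x > 0\<close> q(1) prime_gt_1_nat[of q] by (auto dest!: dvd_imp_le)
  then have "x [^] m \<noteq> \<one>"
    using assms by (simp add: pow_eq_id)
  moreover have "(x [^] m) [^] q = \<one>"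
    using assms m by (simp add: nat_pow_pow mult.commute pow_eq_id)
  ultimately show ?thesis using q(1) by blast
qed

lemma p_elements_order:
  assumes "finite (carrier G)" "x \<in> carrier G" "x [^] (p ^ n) = \<one>" "Factorial_Ring.prime p"
  shows "\<exists>k. order (G\<lparr>carrier := generate G {x}\<rparr>) = p ^ k"
proof -
  have "ord x dvd p ^ n"
    using assms by (simp add: pow_eq_id)
  then show ?thesis
    using assms divides_primepow_nat generate_pow_card by (auto simp: order_def)
qed

lemma ord_prime:
  assumes "x \<in> carrier G" "x \<noteq> \<one>" "x [^] q = \<one>" "Factorial_Ring.prime q"
  shows "ord x = q"
  using assms pow_eq_id[of x q] ord_eq_1[of x] prime_nat_iff by metis

text \<open>The cyclic \<open>p\<close>-group generated by \<open>x\<close> acts on \<open>K\<close>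
  by conjugation. The number of fixed points is divisible by \<open>p\<close> and not zero, since
  \<open>\<one>\<close> is fixed, so some other element commutes with \<open>x\<close>.\<close>

lemma p_group_nontrivial_fixed_point:
  assumes "finite (carrier G)" "x \<in> carrier G" "x [^] (p ^ n) = \<one>" "Factorial_Ring.prime p"
    and K: "subgroup K G" "card K = p ^ m" "K \<noteq> {\<one>}"
    and inv: "\<And>k. k \<in> K \<Longrightarrow> x \<otimes> k \<otimes> inv x \<in> K"
  shows "\<exists>k\<in>K. k \<noteq> \<one> \<and> x \<otimes> k = k \<otimes> x"
proof -
  let ?X = "generate G {x}"
  let ?F = "{k \<in> K. \<forall>g\<in>carrier (G\<lparr>carrier := ?X\<rparr>). g \<otimes> k \<otimes> inv g = k}"
  have Kc: "K \<subseteq> carrier G" using K(1) by (rule subgroup.subset)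
  have finK: "finite K" using Kc assms(1) finite_subset by blast
  obtain k where k: "order (G\<lparr>carrier := ?X\<rparr>) = p ^ k"
    using p_elements_order assms by blast
  have sub: "subgroup ?X G"
    using assms(2) generate_is_subgroup by simp
  have powinv: "x [^] (j::nat) \<otimes> k \<otimes> inv (x [^] j) \<in> K" if "k \<in> K" for k j
    using that
  proof (induction j)
    case (Suc j)
    have "x [^] Suc j \<otimes> k \<otimes> inv (x [^] Suc j) = x \<otimes> (x [^] j \<otimes> k \<otimes> inv (x [^] j)) \<otimes> inv x"
      using assms(2) Suc.prems Kc by (subst conj_conj) (auto simp: nat_pow_Suc2[symmetric])
    then show ?case using Suc inv by simp
  qed (use Kc in auto)
  have "card ?F mod p = card K mod p"
  proof (rule p_group_card_fixed_points[OF subgroup_imp_group[OF sub] assms(4) k finK])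
    fix g y assume "g \<in> carrier (G\<lparr>carrier := ?X\<rparr>)" "y \<in> K"
    then show "g \<otimes> y \<otimes> inv g \<in> K"
      using powinv generate_singleton_iff[OF assms(1,2)] by auto
  next
    fix g h y assume "g \<in> carrier (G\<lparr>carrier := ?X\<rparr>)" "h \<in> carrier (G\<lparr>carrier := ?X\<rparr>)" "y \<in> K"
    then show "g \<otimes>\<^bsub>G\<lparr>carrier := ?X\<rparr>\<^esub> h \<otimes> y \<otimes> inv (g \<otimes>\<^bsub>G\<lparr>carrier := ?X\<rparr>\<^esub> h) = g \<otimes> (h \<otimes> y \<otimes> inv h) \<otimes> inv g"
      using Kc subgroup.subset[OF sub] by (simp add: conj_conj subset_iff)
  qed (use Kc in auto)
  moreover have "m \<noteq> 0"
  proof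
    assume "m = 0"
    then obtain z where "K = {z}" using K(2) by (auto simp: card_1_singleton_iff)
    then show False using K(3) subgroup.one_closed[OF K(1)] by auto
  qed
  ultimately have "p dvd card ?F"
    using K(2) by (simp add: mod_eq_0_iff_dvd)
  moreover have "\<one> \<in> ?F"
    using subgroup.one_closed[OF K(1)] subgroup.subset[OF sub] by auto
  ultimately have "?F \<noteq> {\<one>}"
    using assms(4) by (auto simp: prime_nat_iff)
  then obtain k where "k \<in> ?F" "k \<noteq> \<one>"
    using \<open>\<one> \<in> ?F\<close> by blast
  moreover have "x \<in> carrier (G\<lparr>carrier := ?X\<rparr>)" by (simp add: generate.incl)
  ultimately show ?thesis
    using assms(2) Kc conj_eq_iff_commute[of x] by blast
qed

text \<open>The same count, for \<open>G\<close> acting on itself by conjugation: the fixed points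
  are the central elements.\<close>

lemma p_group_center_nontrivial:
  assumes "finite (carrier G)" "order G = p ^ n" "Factorial_Ring.prime p" "carrier G \<noteq> {\<one>}"
  shows "\<exists>z\<in>carrier G. z \<noteq> \<one> \<and> (\<forall>x\<in>carrier G. x \<otimes> z = z \<otimes> x)"
proof -
  let ?F = "{k \<in> carrier G. \<forall>g\<in>carrier G. g \<otimes> k \<otimes> inv g = k}"
  have "card ?F mod p = card (carrier G) mod p"
    by (rule p_group_card_fixed_points[OF is_group assms(3,2,1)]) (auto simp: conj_conj)
  moreover have "n \<noteq> 0"
    using assms order_one_triv_iff by (metis power_0)
  ultimately have "p dvd card ?F"
    using assms(2) by (simp add: order_def mod_eq_0_iff_dvd)
  moreover have "\<one> \<in> ?F" by auto
  ultimately have "?F \<noteq> {\<one>}"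
    using assms(3) by (auto simp: prime_nat_iff)
  then obtain z where "z \<in> ?F" "z \<noteq> \<one>"
    using \<open>\<one> \<in> ?F\<close> by blast
  then show ?thesis
    using conj_eq_iff_commute by blast
qed

text \<open>The group generated by \<open>x\<close> acts on the right cosets of \<open>Q\<close>,
  and as their number is prime to \<open>q\<close>, it fixes some coset \<open>Q #> g\<close>; this
  says that \<open>g\<close> conjugates \<open>x\<close> into \<open>Q\<close>. Multiplying on the
  right by inverses makes this a left action.\<close>

lemma p_element_conj_into_Sylow:
  assumes "finite (carrier G)" "x \<in> carrier G" "x [^] (q ^ n) = \<one>" "Factorial_Ring.prime q"
    and Q: "subgroup Q G" "\<not> q dvd card (rcosets Q)"
  shows "\<exists>g\<in>carrier G. g \<otimes> x \<otimes> inv g \<in> Q"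
proof -
  let ?X = "generate G {x}"
  let ?F = "{C \<in> rcosets Q. \<forall>g\<in>carrier (G\<lparr>carrier := ?X\<rparr>). C #> inv g = C}"
  have Qc: "Q \<subseteq> carrier G" using Q(1) by (rule subgroup.subset)
  have sub: "subgroup ?X G"
    using assms(2) generate_is_subgroup by simp
  note Xc = subgroup.subset[OF sub]
  obtain k where k: "order (G\<lparr>carrier := ?X\<rparr>) = q ^ k"
    using p_elements_order assms by blast
  have fin: "finite (rcosets Q)"
    using assms(1) by (simp add: RCOSETS_def)
  have "card ?F mod q = card (rcosets Q) mod q"
  proof (rule p_group_card_fixed_points[OF subgroup_imp_group[OF sub] assms(4) k fin])
    fix g C assume "g \<in> carrier (G\<lparr>carrier := ?X\<rparr>)" "C \<in> rcosets Q"
    then show "C #> inv g \<in> rcosets Q"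
      using Xc Qc by (auto simp: RCOSETS_def coset_mult_assoc subset_iff)
  next
    fix C assume "C \<in> rcosets Q"
    then show "C #> inv \<one>\<^bsub>G\<lparr>carrier := ?X\<rparr>\<^esub> = C"
      using subgroup.rcosets_carrier[OF Q(1) is_group] by simp
  next
    fix g h C assume "g \<in> carrier (G\<lparr>carrier := ?X\<rparr>)" "h \<in> carrier (G\<lparr>carrier := ?X\<rparr>)" "C \<in> rcosets Q"
    then show "C #> inv (g \<otimes>\<^bsub>G\<lparr>carrier := ?X\<rparr>\<^esub> h) = C #> inv h #> inv g"
      using Xc subgroup.rcosets_carrier[OF Q(1) is_group]
      by (simp add: subset_iff coset_mult_assoc inv_mult_group)
  qed
  then have "card ?F \<noteq> 0"
    using Q(2) by (metis mod_0 mod_eq_0_iff_dvd)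
  then obtain C where C: "C \<in> ?F"
    by (metis (no_types, lifting) card.empty ex_in_conv)
  then obtain g where g: "g \<in> carrier G" "C = Q #> g"
    by (auto simp: RCOSETS_def)
  have "x \<in> ?X" by (simp add: generate.incl)
  then have "C #> inv x = C" using C by auto
  then have "Q #> (g \<otimes> inv x) = Q #> g"
    using g Qc assms(2) by (simp add: coset_mult_assoc)
  then have "g \<otimes> inv x \<in> Q #> g"
    using rcos_self[OF _ Q(1), of "g \<otimes> inv x"] g assms(2) by simp
  then have "g \<otimes> inv x \<otimes> inv g \<in> Q"
    using subgroup.rcos_module_imp[OF Q(1) is_group] g by blast
  then have "inv (g \<otimes> inv x \<otimes> inv g) \<in> Q"
    by (rule subgroup.m_inv_closed[OF Q(1)])
  moreover have "inv (g \<otimes> inv x \<otimes> inv g) = g \<otimes> x \<otimes> inv g"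
    using conj_inv[OF g(1), of "inv x"] assms(2) by simp
  ultimately show ?thesis
    using g(1) by (intro bexI[of _ g]) simp_all
qed

end

section \<open>Counting conjugates of a Frobenius complement\<close>

context group
begin

text \<open>Conjugating by \<open>inv g\<close> moves \<open>w\<close> to a nontrivial element of
  \<open>H\<close> that also lies in the conjugate of \<open>H\<close> by
  \<open>inv g \<otimes> h\<close>; the defining property of a complement then forces
  \<open>inv g \<otimes> h\<close> into \<open>H\<close>. With \<open>conj_set_eqI\<close>, distinct
  conjugates meet trivially.\<close>

lemma frobenius_complement_conj_Int:
  assumes "frobenius_complement G H" "g \<in> carrier G" "h \<in> carrier G"
    and "w \<in> g <# (H #> inv g)" "w \<in> h <# (H #> inv h)" "w \<noteq> \<one>"
  shows "inv g \<otimes> h \<in> H"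
proof (rule ccontr)
  assume not: "inv g \<otimes> h \<notin> H"
  have sub: "subgroup H G"
    using assms(1) by (simp add: frobenius_complement_def)
  note Hc = subgroup.subset[OF sub]
  let ?k = "inv g \<otimes> h" and ?u = "inv g \<otimes> w \<otimes> g"
  have w: "w \<in> carrier G" "?u \<in> H" "inv h \<otimes> w \<otimes> h \<in> H"
    using assms mem_conj_set_iff[OF Hc] by auto
  have "inv h \<otimes> w \<otimes> h = inv ?k \<otimes> ?u \<otimes> ?k"
    using conj_conj[of "inv ?k" "inv g" w] w(1) assms(2,3) by (simp add: inv_mult_group m_assoc)
  then have "?u \<in> H \<inter> (?k <# (H #> inv ?k))"
    using w assms(2,3) mem_conj_set_iff[OF Hc, of ?k] by simp
  moreover have "?k \<in> carrier G - H"
    using not assms by simp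
  ultimately have "?u = \<one>"
    using assms(1) unfolding frobenius_complement_def by blast
  then show False
    using conj_eq_one_iff[of "inv g" w] assms(2,6) w(1) by simp
qed

lemma conj_set_eqI:
  assumes "subgroup H G" "g \<in> carrier G" "h \<in> carrier G" "inv g \<otimes> h \<in> H"
  shows "g <# (H #> inv g) = h <# (H #> inv h)"
proof -
  note Hc = subgroup.subset[OF assms(1)]
  have *: "inv h \<otimes> x \<otimes> h \<in> H" if "g \<in> carrier G" "h \<in> carrier G" "inv g \<otimes> h \<in> H"
    "x \<in> carrier G" "inv g \<otimes> x \<otimes> g \<in> H" for g h x
  proof -
    let ?k = "inv g \<otimes> h"
    have "inv h \<otimes> x \<otimes> h = inv ?k \<otimes> (inv g \<otimes> x \<otimes> g) \<otimes> ?k"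
      using conj_conj[of "inv ?k" "inv g" x] that by (simp add: inv_mult_group m_assoc)
    then show ?thesis
      using that(3,5) assms(1) by (simp add: subgroup.m_closed subgroup.m_inv_closed)
  qed
  have "inv (inv g \<otimes> h) \<in> H"
    by (rule subgroup.m_inv_closed[OF assms(1,4)])
  then have "inv h \<otimes> g \<in> H"
    using assms by (simp add: inv_mult_group)
  then have "inv g \<otimes> x \<otimes> g \<in> H \<longleftrightarrow> inv h \<otimes> x \<otimes> h \<in> H" if "x \<in> carrier G" for x
    using *[OF assms(2-4) that] *[OF assms(3,2) _ that] by blast
  then show ?thesis
    by (simp add: set_eq_iff mem_conj_set_iff[OF Hc] assms(2,3) cong: conj_cong)
qed

lemma conj_set_eq_image:
  assumes "H \<subseteq> carrier G" "g \<in> carrier G"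
  shows "g <# (H #> inv g) = (\<lambda>h. g \<otimes> h \<otimes> inv g) ` H"
  using assms by (auto simp: l_coset_def r_coset_def m_assoc subset_iff)

lemma card_conj_set:
  assumes "H \<subseteq> carrier G" "g \<in> carrier G"
  shows "card (g <# (H #> inv g)) = card H"
proof -
  have "inj_on (\<lambda>h. g \<otimes> h \<otimes> inv g) H"
    by (rule inj_on_inverseI[of _ "\<lambda>x. inv g \<otimes> x \<otimes> g"]) (use assms in auto)
  then show ?thesis
    by (simp add: conj_set_eq_image[OF assms] card_image)
qed

lemma frobenius_complement_conj_set_eq_iff:
  assumes "frobenius_complement G H" "g \<in> carrier G" "h \<in> carrier G"
  shows "g <# (H #> inv g) = h <# (H #> inv h) \<longleftrightarrow> inv g \<otimes> h \<in> H"
proof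
  assume eq: "g <# (H #> inv g) = h <# (H #> inv h)"
  have sub: "subgroup H G" "H \<noteq> {\<one>}"
    using assms(1) by (simp_all add: frobenius_complement_def)
  then obtain u where u: "u \<in> H" "u \<noteq> \<one>"
    using subgroup.one_closed by blast
  have uc: "u \<in> carrier G"
    using u sub subgroup.mem_carrier by fast
  have "g \<otimes> u \<otimes> inv g \<in> g <# (H #> inv g)"
    using mem_conj_set_iff[OF subgroup.subset[OF sub(1)] assms(2)] assms(2) u(1) uc by simp
  then show "inv g \<otimes> h \<in> H"
    using frobenius_complement_conj_Int[OF assms] eq u uc assms(2) by simp
next
  assume "inv g \<otimes> h \<in> H"
  then show "g <# (H #> inv g) = h <# (H #> inv h)"
    using assms conj_set_eqI by (simp add: frobenius_complement_def)
qed

text \<open>A complement is its own normalizer, so the fibres of the map from \<open>g\<close> to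
  the conjugate of \<open>H\<close> by \<open>g\<close> are the left cosets of
  \<open>H\<close>.\<close>

lemma card_conjugates_frobenius_complement:
  assumes "finite (carrier G)" "frobenius_complement G H"
  shows "card ((\<lambda>g. g <# (H #> inv g)) ` carrier G) * card H = order G"
proof -
  let ?C = "\<lambda>g. g <# (H #> inv g)"
  have sub: "subgroup H G"
    using assms(2) by (simp add: frobenius_complement_def)
  note Hc = subgroup.subset[OF sub]
  have fiber: "card {x \<in> carrier G. ?C x = ?C g} = card H" if g: "g \<in> carrier G" for g
  proof -
    have "{x \<in> carrier G. ?C x = ?C g} = (\<lambda>h. g \<otimes> h) ` H"
    proof (intro equalityI subsetI)
      fix x assume "x \<in> {x \<in> carrier G. ?C x = ?C g}"
      then have x: "x \<in> carrier G" "?C x = ?C g" by auto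
      then have "inv g \<otimes> x \<in> H"
        using frobenius_complement_conj_set_eq_iff[OF assms(2) g x(1)] by simp
      moreover have "x = g \<otimes> (inv g \<otimes> x)"
        using x g by (simp flip: m_assoc)
      ultimately show "x \<in> (\<lambda>h. g \<otimes> h) ` H" by blast
    next
      fix x assume "x \<in> (\<lambda>h. g \<otimes> h) ` H"
      then obtain h where h: "h \<in> H" "x = g \<otimes> h" by blast
      then have hc: "h \<in> carrier G" using Hc by blast
      have "inv g \<otimes> (g \<otimes> h) = h" using g hc by (simp flip: m_assoc)
      then have "?C g = ?C (g \<otimes> h)"
        using frobenius_complement_conj_set_eq_iff[OF assms(2) g, of "g \<otimes> h"] g hc h by simp
      then show "x \<in> {x \<in> carrier G. ?C x = ?C g}"
        using g hc h(2) by simp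
    qed
    moreover have "inj_on (\<lambda>h. g \<otimes> h) H"
      using g Hc by (auto intro!: inj_onI simp: subset_iff)
    ultimately show ?thesis by (simp add: card_image)
  qed
  have "order G = (\<Sum>x\<in>carrier G. 1)"
    by (simp add: order_def)
  also have "\<dots> = (\<Sum>c\<in>?C ` carrier G. \<Sum>x\<in>{x. x \<in> carrier G \<and> ?C x = c}. 1)"
    by (rule sum.image_gen[OF assms(1)])
  also have "\<dots> = (\<Sum>c\<in>?C ` carrier G. card H)"
    using fiber by (intro sum.cong) auto
  finally show ?thesis by simp
qed

text \<open>Without the identity, the conjugates are pairwise disjoint with
  \<open>card H - 1\<close> elements each. If there are \<open>k\<close> of them, they cover
  \<open>k * (card H - 1)\<close> of the \<open>k * card H\<close> elements of the group, which
  leaves \<open>k\<close> for the kernel. The \<open>+ 1\<close> in the last equation is the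
  identity, which both sets contain.\<close>

lemma card_frobenius_kernel:
  assumes "finite (carrier G)" "frobenius_complement G H"
  shows "card (frobenius_kernel G H) = card ((\<lambda>g. g <# (H #> inv g)) ` carrier G)"
    and "card (frobenius_kernel G H) * card H = order G"
    and "card (\<Union>g\<in>carrier G. g <# (H #> inv g)) + card (frobenius_kernel G H) = order G + 1"
proof -
  let ?C = "\<lambda>g. g <# (H #> inv g)"
  let ?K = "?C ` carrier G"
  let ?U = "\<Union>c\<in>?K. c - {\<one>}"
  have sub: "subgroup H G"
    using assms(2) by (simp add: frobenius_complement_def)
  note Hc = subgroup.subset[OF sub]
  have Cc: "?C g \<subseteq> carrier G" if "g \<in> carrier G" for g
    using that mem_conj_set_iff[OF Hc] by blast
  have one: "\<one> \<in> ?C g" if "g \<in> carrier G" for g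
    using that mem_conj_set_iff[OF Hc] subgroup.one_closed[OF sub] by simp
  have "card ?U = (\<Sum>c\<in>?K. card (c - {\<one>}))"
  proof (rule card_UN_disjoint)
    show "\<forall>c\<in>?K. finite (c - {\<one>})"
      using Cc assms(1) finite_subset by blast
    show "\<forall>c\<in>?K. \<forall>d\<in>?K. c \<noteq> d \<longrightarrow> (c - {\<one>}) \<inter> (d - {\<one>}) = {}"
      using frobenius_complement_conj_Int[OF assms(2)] frobenius_complement_conj_set_eq_iff[OF assms(2)]
      by blast
  qed (use assms(1) in simp)
  also have "\<dots> = (\<Sum>c\<in>?K. card H - 1)"
    using card_conj_set[OF Hc] one by (intro sum.cong) (auto simp: card_Diff_singleton)
  finally have U: "card ?U = card ?K * (card H - 1)" by simp
  have Uc: "?U \<subseteq> carrier G" using Cc by blast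
  have finU: "finite ?U" using Uc assms(1) finite_subset by blast
  have Hpos: "card H > 0"
    using sub assms(1) Hc subgroup.one_closed[OF sub] by (auto simp: card_gt_0_iff intro: finite_subset)
  have ord: "card ?K * card H = order G"
    using card_conjugates_frobenius_complement[OF assms] .
  have sum: "card ?U + card ?K = order G"
  proof -
    have "k * (n - 1) + k = k * n" if "n > 0" for k n :: nat
      using that by (cases n) simp_all
    then show ?thesis
      unfolding U using Hpos ord by metis
  qed
  have "frobenius_kernel G H = carrier G - ?U"
    unfolding frobenius_kernel_def using one_closed by blast
  then have "card (frobenius_kernel G H) = order G - card ?U"
    using Uc finU by (simp add: card_Diff_subset order_def)
  also have "\<dots> = card ?K"
    using sum by linarith
  finally show 1: "card (frobenius_kernel G H) = card ?K" .
  then show "card (frobenius_kernel G H) * card H = order G"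
    using ord by simp
  have "(\<Union>g\<in>carrier G. ?C g) = insert \<one> ?U"
    using one by auto
  then have "card (\<Union>g\<in>carrier G. ?C g) = card ?U + 1"
    using card_insert_disjoint[OF finU, of \<one>] by fastforce
  then show "card (\<Union>g\<in>carrier G. ?C g) + card (frobenius_kernel G H) = order G + 1"
    using 1 sum by simp
qed

end

section \<open>Groups of rank at most one with a fixed-point-free automorphism\<close>

text \<open>Natural exponents yield the full cyclic subgroup when the group is finite
  (\<open>generate_eq_powers\<close>), and they do not depend on the carrier, so
  \<open>powers\<close> moves freely between a group and its subgroups.\<close>

definition powers :: "('a, 'b) monoid_scheme \<Rightarrow> 'a \<Rightarrow> 'a set" where
  "powers G x = range (\<lambda>k::nat. x [^]\<^bsub>G\<^esub> k)"

text \<open>For a finite group this says that no subgroup is isomorphic to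
  \<open>C_r \<times> C_r\<close> with \<open>r\<close> prime. The elementwise form passes to
  subgroups at once and can be checked on representatives in a quotient.\<close>

definition rank_le_one :: "('a, 'b) monoid_scheme \<Rightarrow> bool" where
  "rank_le_one G \<longleftrightarrow>
     (\<forall>r x y. Factorial_Ring.prime (r::nat) \<longrightarrow> x \<in> carrier G \<longrightarrow> y \<in> carrier G \<longrightarrow>
        x \<otimes>\<^bsub>G\<^esub> y = y \<otimes>\<^bsub>G\<^esub> x \<longrightarrow> x [^]\<^bsub>G\<^esub> r = \<one>\<^bsub>G\<^esub> \<longrightarrow> y [^]\<^bsub>G\<^esub> r = \<one>\<^bsub>G\<^esub> \<longrightarrow>
        x \<noteq> \<one>\<^bsub>G\<^esub> \<longrightarrow> y \<in> powers G x)"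

lemma rank_le_oneD:
  assumes "rank_le_one G" "Factorial_Ring.prime (r::nat)" "x \<in> carrier G" "y \<in> carrier G"
    "x \<otimes>\<^bsub>G\<^esub> y = y \<otimes>\<^bsub>G\<^esub> x" "x [^]\<^bsub>G\<^esub> r = \<one>\<^bsub>G\<^esub>" "y [^]\<^bsub>G\<^esub> r = \<one>\<^bsub>G\<^esub>" "x \<noteq> \<one>\<^bsub>G\<^esub>"
  shows "y \<in> powers G x"
  using assms unfolding rank_le_one_def by blast

lemma powers_carrier_update: "powers (G\<lparr>carrier := H\<rparr>) x = powers G x"
  by (simp add: powers_def nat_pow_def)

section \<open>Cyclic subgroups as power sets, elements of prime order, centralizers\<close>

context group
begin

lemma pow_in_powers: "x [^] (k::nat) \<in> powers G x"
  by (simp add: powers_def)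

lemma self_in_powers: "x \<in> carrier G \<Longrightarrow> x \<in> powers G x"
  using pow_in_powers[of x 1] by simp

lemma one_in_powers: "\<one> \<in> powers G x"
  using pow_in_powers[of x 0] by simp

lemma powers_in_carrier: "x \<in> carrier G \<Longrightarrow> powers G x \<subseteq> carrier G"
  by (auto simp: powers_def)

lemma powers_trans:
  assumes "x \<in> carrier G" "y \<in> powers G x" "z \<in> powers G y"
  shows "z \<in> powers G x"
  using assms by (auto simp: powers_def nat_pow_pow)

lemma powers_mult:
  assumes "x \<in> carrier G" "y \<in> powers G x" "z \<in> powers G x"
  shows "y \<otimes> z \<in> powers G x"
  using assms by (auto simp: powers_def nat_pow_mult)

lemma powers_commute:
  assumes "x \<in> carrier G" "y \<in> powers G x" "z \<in> powers G x"
  shows "y \<otimes> z = z \<otimes> y"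
  using assms by (auto simp: powers_def nat_pow_comm)

lemma powers_subset_subgroup:
  assumes "subgroup H G" "x \<in> H"
  shows "powers G x \<subseteq> H"
  using subgroup_pow_closed[OF assms] by (auto simp: powers_def)

lemma generate_eq_powers:
  assumes "finite (carrier G)" "x \<in> carrier G"
  shows "generate G {x} = powers G x"
  using generate_pow_on_finite_carrier[OF assms] by (auto simp: powers_def)

lemma subgroup_powers:
  assumes "finite (carrier G)" "x \<in> carrier G"
  shows "subgroup (powers G x) G"
  using generate_is_subgroup[of "{x}"] generate_eq_powers assms by simp

lemma powers_pow_prime:
  assumes "x \<in> carrier G" "x [^] (q::nat) = \<one>" "y \<in> powers G x"
  shows "y [^] q = \<one>"
proof -
  obtain k :: nat where "y = x [^] k" using assms(3) by (auto simp: powers_def)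
  then have "y [^] q = (x [^] q) [^] k"
    using assms(1) by (simp add: nat_pow_pow mult.commute)
  then show ?thesis using assms(2) by simp
qed

lemma mem_powers_coprime:
  fixes k :: nat
  assumes "x \<in> carrier G" "coprime k (ord x)"
  shows "x \<in> powers G (x [^] k)"
proof (cases "k = 0")
  case True
  then have "x = \<one>" using assms ord_eq_1 by simp
  then show ?thesis by (simp add: one_in_powers)
next
  case False
  then obtain a b where "k * a = ord x * b + 1"
    using bezout_nat[of k "ord x"] assms(2) by auto
  then have "(x [^] k) [^] a = x"
    using assms(1) by (simp add: nat_pow_pow flip: nat_pow_mult)
       (simp flip: nat_pow_pow)
  then show ?thesis using pow_in_powers by metis
qed

lemma mem_powers_same_ord:
  assumes "finite (carrier G)" "x \<in> carrier G" "y \<in> powers G x" "ord y = ord x"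
  shows "x \<in> powers G y"
  using assms mem_powers_coprime pow_ord_eq_ord_iff by (auto simp: powers_def)

lemma mem_powers_prime:
  assumes "x \<in> carrier G" "x [^] (q::nat) = \<one>" "Factorial_Ring.prime q" "y \<in> powers G x" "y \<noteq> \<one>"
  shows "x \<in> powers G y"
proof -
  obtain k :: nat where k: "y = x [^] k" using assms(4) by (auto simp: powers_def)
  have "x \<noteq> \<one>" using k assms(5) by auto
  then have "ord x = q" using ord_prime assms by blast
  moreover have "\<not> q dvd k"
    using assms(1,2,5) k \<open>ord x = q\<close> pow_eq_id by blast
  ultimately have "coprime k (ord x)"
    using assms(3) prime_imp_coprime coprime_commute by metis
  then show ?thesis using mem_powers_coprime assms(1) k by blast
qed

lemma rank_le_one_subgroup:
  assumes "rank_le_one G" "subgroup H G"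
  shows "rank_le_one (G\<lparr>carrier := H\<rparr>)"
  using assms(1) subgroup.subset[OF assms(2)]
  unfolding rank_le_one_def by (auto simp: powers_carrier_update pow_carrier_update)

text \<open>The centre of a Sylow \<open>q\<close>-subgroup \<open>Q\<close> contains an element
  \<open>z\<close> of order \<open>q\<close>. Any \<open>x\<close> with
  \<open>x [^] q = \<one>\<close> has a conjugate in \<open>Q\<close>; this commutes with
  \<open>z\<close>, and rank at most one makes it a power of \<open>z\<close>. So all subgroups of
  order \<open>q\<close> are conjugate.\<close>

lemma prime_order_elements_conjugate:
  fixes q :: nat
  assumes fin: "finite (carrier G)" and "rank_le_one G" and q: "Factorial_Ring.prime q"
    and x0: "x0 \<in> carrier G" "x0 \<noteq> \<one>" "x0 [^] q = \<one>"
  shows "\<exists>z\<in>carrier G. z \<noteq> \<one> \<and> z [^] q = \<one> \<and>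
           (\<forall>x\<in>carrier G. x [^] q = \<one> \<longrightarrow> (\<exists>g\<in>carrier G. g \<otimes> x \<otimes> inv g \<in> powers G z))"
proof -
  have "q dvd order G"
    using ord_dvd_group_order[OF x0(1)] ord_prime[OF x0 q] by simp
  have "order G > 0" using fin order_gt_0_iff_finite by blast
  then obtain m where m: "order G = q ^ multiplicity q (order G) * m" "\<not> q dvd m"
    using multiplicity_decompose'[of "order G" q] q not_prime_unit by (metis gr_implies_not0)
  define a where "a = multiplicity q (order G)"
  have "a > 0"
    using m \<open>q dvd order G\<close> unfolding a_def by (cases "multiplicity q (order G)") auto
  obtain Q where Q: "subgroup Q G" "card Q = q ^ a"
    using sylow_thm[OF q is_group m(1) fin] unfolding a_def by blast
  let ?Q = "G\<lparr>carrier := Q\<rparr>"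
  interpret Q: group ?Q
    using Q(1) by (rule subgroup_imp_group)
  have Qc: "Q \<subseteq> carrier G" using Q(1) by (rule subgroup.subset)
  have finQ: "finite (carrier ?Q)" using Qc fin finite_subset by auto
  have "card Q > 1" using one_less_power[OF prime_gt_1_nat[OF q] \<open>a > 0\<close>] Q(2) by simp
  then have nontriv: "carrier ?Q \<noteq> {\<one>\<^bsub>?Q\<^esub>}" by auto
  have ordQ: "order ?Q = q ^ a" using Q(2) by (simp add: order_def)
  then obtain z0 where z0: "z0 \<in> Q" "z0 \<noteq> \<one>" "\<And>x. x \<in> Q \<Longrightarrow> x \<otimes> z0 = z0 \<otimes> x"
    using Q.p_group_center_nontrivial[OF finQ ordQ q nontriv] by auto
  have z0c: "z0 \<in> carrier G" using z0 Qc by blast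
  \<comment> \<open>\<open>r\<close> is only some prime here; it turns out to be \<open>q\<close>
    because \<open>z\<close> lies in \<open>Q\<close>, whose order is a power of
    \<open>q\<close>.\<close>
  obtain r j :: nat where r: "Factorial_Ring.prime r" "z0 [^] j \<noteq> \<one>" "(z0 [^] j) [^] r = \<one>"
    using exists_prime_order_pow[OF fin z0c z0(2)] by blast
  define z where "z = z0 [^] j"
  have zQ: "z \<in> Q" unfolding z_def using subgroup_pow_closed[OF Q(1) z0(1)] .
  have z: "z \<in> carrier G" "z \<noteq> \<one>" "z [^] r = \<one>"
    using zQ Qc r by (auto simp: z_def)
  have "z [^] (q ^ a) = \<one>"
    using Q.pow_order_eq_1[of z] zQ Q(2) by (simp add: order_def pow_carrier_update)
  then have "r dvd q ^ a"
    using pow_eq_id[OF z(1)] ord_prime[OF z r(1)] by simp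
  then have "r = q"
    using r(1) q prime_dvd_power primes_dvd_imp_eq by blast
  have comm: "z \<otimes> x = x \<otimes> z" if "x \<in> Q" for x
    unfolding z_def using group_commutes_pow[of z0 x j] z0(3)[OF that] z0c that Qc by auto
  have "card (rcosets Q) * q ^ a = m * q ^ a"
    using lagrange[OF Q(1)] Q(2) m(1) by (simp add: a_def mult.commute)
  then have "\<not> q dvd card (rcosets Q)"
    using m(2) q by (auto simp: prime_gt_0_nat)
  then have conj: "\<exists>g\<in>carrier G. g \<otimes> x \<otimes> inv g \<in> Q" if "x \<in> carrier G" "x [^] q = \<one>" for x
    using p_element_conj_into_Sylow[OF fin that(1) _ q Q(1), of 1] that by simp
  have "\<exists>g\<in>carrier G. g \<otimes> x \<otimes> inv g \<in> powers G z" if x: "x \<in> carrier G" "x [^] q = \<one>" for x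
  proof -
    obtain g where g: "g \<in> carrier G" "g \<otimes> x \<otimes> inv g \<in> Q"
      using conj[OF x] by blast
    have "g \<otimes> x \<otimes> inv g \<in> powers G z"
      using rank_le_oneD[OF assms(2) q z(1), of "g \<otimes> x \<otimes> inv g"] g x z comm[OF g(2)] \<open>r = q\<close>
      by (simp add: conj_pow)
    then show ?thesis using g(1) by blast
  qed
  then show ?thesis using z \<open>r = q\<close> by blast
qed

definition centralizer :: "'a \<Rightarrow> 'a set" where
  "centralizer y = {x \<in> carrier G. x \<otimes> y = y \<otimes> x}"

lemma subgroup_centralizer:
  assumes "y \<in> carrier G"
  shows "subgroup (centralizer y) G"
proof (rule subgroup.intro)
  fix a b assume "a \<in> centralizer y" "b \<in> centralizer y"
  then show "a \<otimes> b \<in> centralizer y"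
    using assms by (auto simp: centralizer_def m_assoc) (simp flip: m_assoc)
next
  fix a assume a: "a \<in> centralizer y"
  then have "inv a \<otimes> y = y \<otimes> inv a"
    using assms by (auto simp: centralizer_def) (metis inv_solve_left inv_solve_right inv_closed m_assoc m_closed)
  then show "inv a \<in> centralizer y"
    using a by (simp add: centralizer_def)
qed (use assms in \<open>auto simp: centralizer_def\<close>)

lemma self_in_centralizer: "y \<in> carrier G \<Longrightarrow> y \<in> centralizer y"
  by (simp add: centralizer_def)

lemma mem_centralizer_powers:
  assumes "x \<in> carrier G" "y \<in> carrier G" "x \<otimes> y = y \<otimes> x" "w \<in> powers G y"
  shows "x \<in> centralizer w"
  using assms group_commutes_pow[of y x] by (auto simp: powers_def centralizer_def)

lemma conj_mem_centralizer_iff: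
  assumes "g \<in> carrier G" "x \<in> carrier G" "y \<in> carrier G"
  shows "g \<otimes> x \<otimes> inv g \<in> centralizer (g \<otimes> y \<otimes> inv g) \<longleftrightarrow> x \<in> centralizer y"
proof -
  have "g \<otimes> x \<otimes> inv g \<otimes> (g \<otimes> y \<otimes> inv g) = g \<otimes> y \<otimes> inv g \<otimes> (g \<otimes> x \<otimes> inv g)
      \<longleftrightarrow> g \<otimes> (x \<otimes> y) \<otimes> inv g = g \<otimes> (y \<otimes> x) \<otimes> inv g"
    using assms by (simp add: conj_mult)
  also have "\<dots> \<longleftrightarrow> x \<otimes> y = y \<otimes> x"
    using assms by simp
  finally show ?thesis
    using assms by (simp add: centralizer_def)
qed

lemma conj_centralizer:
  assumes "g \<in> carrier G" "y \<in> carrier G"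
  shows "g <# (centralizer y #> inv g) = centralizer (g \<otimes> y \<otimes> inv g)"
proof -
  have "x \<in> g <# (centralizer y #> inv g) \<longleftrightarrow> x \<in> centralizer (g \<otimes> y \<otimes> inv g)" for x
  proof (cases "x \<in> carrier G")
    case True
    then show ?thesis
      using mem_conj_set_iff[of "centralizer y" g x] conj_mem_centralizer_iff[of g "inv g \<otimes> x \<otimes> g" y]
        subgroup.subset[OF subgroup_centralizer[OF assms(2)]] assms
      by simp
  next
    case False
    then show ?thesis
      using mem_conj_set_iff[of "centralizer y" g x] subgroup.subset[OF subgroup_centralizer[OF assms(2)]] assms
      by (simp add: centralizer_def)
  qed
  then show ?thesis by blast
qed

end

section \<open>Fixed-point-free automorphisms and the Lang map
  \<open>inv x \<otimes> \<alpha> x\<close>\<close>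

locale fpf_group = group +
  fixes \<alpha> :: "'a \<Rightarrow> 'a"
  assumes finite_carrier: "finite (carrier G)"
    and iso: "\<alpha> \<in> iso G G"
    and fpf: "\<And>x. x \<in> carrier G \<Longrightarrow> \<alpha> x = x \<Longrightarrow> x = \<one>"
    and rank: "rank_le_one G"
begin

lemma aut_closed [simp]: "x \<in> carrier G \<Longrightarrow> \<alpha> x \<in> carrier G"
  and aut_mult: "x \<in> carrier G \<Longrightarrow> y \<in> carrier G \<Longrightarrow> \<alpha> (x \<otimes> y) = \<alpha> x \<otimes> \<alpha> y"
  using iso by (auto simp: iso_def hom_def)

lemma aut_group_hom: "group_hom G G \<alpha>"
  using iso by unfold_locales (simp add: iso_def)

lemma aut_one: "\<alpha> \<one> = \<one>"
  using group_hom.hom_one[OF aut_group_hom] .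

lemma aut_inv: "x \<in> carrier G \<Longrightarrow> \<alpha> (inv x) = inv (\<alpha> x)"
  using group_hom.hom_inv[OF aut_group_hom] .

lemma aut_pow: "x \<in> carrier G \<Longrightarrow> \<alpha> (x [^] (n::nat)) = \<alpha> x [^] n"
  using group_hom.hom_nat_pow[OF aut_group_hom] .

lemma aut_inj: "inj_on \<alpha> (carrier G)"
  using iso by (simp add: iso_def bij_betw_def)

lemma aut_eq_one: "x \<in> carrier G \<Longrightarrow> \<alpha> x = \<one> \<longleftrightarrow> x = \<one>"
  using aut_inj aut_one by (metis inj_onD one_closed)

lemma ord_aut: "x \<in> carrier G \<Longrightarrow> ord (\<alpha> x) = ord x"
  using ord_unique[of "\<alpha> x" "ord x"] by (simp add: aut_eq_one pow_eq_id flip: aut_pow)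

lemma aut_conj:
  assumes "g \<in> carrier G" "x \<in> carrier G"
  shows "\<alpha> (g \<otimes> x \<otimes> inv g) = \<alpha> g \<otimes> \<alpha> x \<otimes> inv (\<alpha> g)"
  using assms by (simp add: aut_mult aut_inv)

lemma aut_powers: "x \<in> carrier G \<Longrightarrow> y \<in> powers G x \<Longrightarrow> \<alpha> y \<in> powers G (\<alpha> x)"
  by (auto simp: powers_def aut_pow)

text \<open>Equality of the two values means that \<alpha> fixes
  \<open>x \<otimes> inv y\<close>.\<close>

lemma lang_inj:
  assumes "x \<in> carrier G" "y \<in> carrier G" "inv x \<otimes> \<alpha> x = inv y \<otimes> \<alpha> y"
  shows "x = y"
proof -
  have "\<alpha> x = x \<otimes> (inv y \<otimes> \<alpha> y)"
    using assms by (metis aut_closed inv_closed inv_solve_left m_closed)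
  then have "\<alpha> (x \<otimes> inv y) = x \<otimes> inv y"
    using assms(1,2) by (simp add: aut_mult aut_inv m_assoc)
  then have "x \<otimes> inv y = \<one>"
    using assms fpf by simp
  then show ?thesis
    using assms by (metis inv_equality inv_inv inv_closed)
qed

text \<open>An analogue of Lang's theorem: on a finite invariant subgroup the map is injective by
  \<open>lang_inj\<close>, hence onto. For proper \<open>M\<close> it gives preimages inside
  \<open>M\<close>, as the arguments with centralizers and with \<open>P\<close> require.\<close>

lemma lang_surj:
  assumes "subgroup M G" "\<alpha> ` M \<subseteq> M" "y \<in> M"
  shows "\<exists>x\<in>M. inv x \<otimes> \<alpha> x = y"
proof -
  let ?f = "\<lambda>x. inv x \<otimes> \<alpha> x"
  have Mc: "M \<subseteq> carrier G" using assms(1) by (rule subgroup.subset)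
  have "?f ` M \<subseteq> M"
    using assms(1,2) by (auto intro!: subgroup.m_closed subgroup.m_inv_closed)
  moreover have "inj_on ?f M"
    using lang_inj Mc by (auto intro!: inj_onI)
  moreover have "finite M" using finite_carrier Mc finite_subset by blast
  ultimately have "?f ` M = M"
    using endo_inj_surj by blast
  then have "y \<in> ?f ` M" using assms(3) by simp
  then show ?thesis by (rule imageE) auto
qed

lemma fpf_subgroup:
  assumes "subgroup M G" "\<alpha> ` M \<subseteq> M"
  shows "fpf_group (G\<lparr>carrier := M\<rparr>) \<alpha>"
proof -
  have Mc: "M \<subseteq> carrier G" using assms(1) by (rule subgroup.subset)
  interpret M: group "G\<lparr>carrier := M\<rparr>" using assms(1) by (rule subgroup_imp_group)
  have "finite M" using finite_carrier Mc finite_subset by blast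
  have inj: "inj_on \<alpha> M" using aut_inj Mc inj_on_subset by blast
  then have "\<alpha> ` M = M" using assms(2) \<open>finite M\<close> endo_inj_surj by blast
  then have "\<alpha> \<in> iso (G\<lparr>carrier := M\<rparr>) (G\<lparr>carrier := M\<rparr>)"
    using inj Mc by (auto simp: iso_def hom_def bij_betw_def aut_mult subset_iff)
  then show ?thesis
    using \<open>finite M\<close> fpf Mc rank_le_one_subgroup[OF rank assms(1)]
    by unfold_locales (auto simp: subset_iff)
qed

text \<open>All elements of order \<open>q\<close> can be conjugated into one group of order
  \<open>q\<close>, so a conjugate \<open>y\<close> of \<open>x\<close> satisfies
  \<open>h \<otimes> \<alpha> y \<otimes> inv h \<in> powers G y\<close> for some \<open>h\<close>.
  Writing \<open>h\<close> as \<open>inv v \<otimes> \<alpha> v\<close> turns this twisted condition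
  into invariance for the conjugate of \<open>y\<close> by \<open>v\<close>.\<close>

lemma prime_order_conj_aut_invariant:
  fixes q :: nat
  assumes "x \<in> carrier G" "x \<noteq> \<one>" "x [^] q = \<one>" "Factorial_Ring.prime q"
  shows "\<exists>u\<in>carrier G. \<alpha> (u \<otimes> x \<otimes> inv u) \<in> powers G (u \<otimes> x \<otimes> inv u)"
proof -
  obtain z where z: "z \<in> carrier G" "z \<noteq> \<one>" "z [^] q = \<one>"
    and conj: "\<And>x. x \<in> carrier G \<Longrightarrow> x [^] q = \<one> \<Longrightarrow> \<exists>g\<in>carrier G. g \<otimes> x \<otimes> inv g \<in> powers G z"
    using prime_order_elements_conjugate[OF finite_carrier rank assms(4,1,2,3)] by blast
  obtain g where g: "g \<in> carrier G" "g \<otimes> x \<otimes> inv g \<in> powers G z"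
    using conj assms by blast
  define y where "y = g \<otimes> x \<otimes> inv g"
  have y: "y \<in> carrier G" "y \<noteq> \<one>" "y [^] q = \<one>"
    using assms g(1) by (simp_all add: y_def conj_pow)
  have zy: "z \<in> powers G y"
    using mem_powers_prime[OF z(1,3) assms(4)] g(2) y(2) by (simp add: y_def)
  have "\<alpha> y [^] q = \<one>"
    using y by (simp add: aut_one flip: aut_pow)
  then obtain h where h: "h \<in> carrier G" "h \<otimes> \<alpha> y \<otimes> inv h \<in> powers G z"
    using conj[of "\<alpha> y"] y by auto
  then have hy: "h \<otimes> \<alpha> y \<otimes> inv h \<in> powers G y"
    using powers_trans y(1) zy by blast
  obtain v where v: "v \<in> carrier G" "inv v \<otimes> \<alpha> v = h"
    using lang_surj[OF subgroup_self _ h(1)] aut_closed by blast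
  then have av: "\<alpha> v = v \<otimes> h"
    using h(1) by (metis aut_closed inv_solve_left)
  obtain k :: nat where k: "h \<otimes> \<alpha> y \<otimes> inv h = y [^] k"
    using hy by (auto simp: powers_def)
  have "\<alpha> (v \<otimes> y \<otimes> inv v) = v \<otimes> (h \<otimes> \<alpha> y \<otimes> inv h) \<otimes> inv v"
    using v h(1) y(1) by (simp add: aut_conj av conj_conj)
  also have "\<dots> = (v \<otimes> y \<otimes> inv v) [^] k"
    using v y by (simp add: k conj_pow)
  finally have "\<alpha> (v \<otimes> y \<otimes> inv v) \<in> powers G (v \<otimes> y \<otimes> inv v)"
    by (simp add: pow_in_powers)
  moreover have "v \<otimes> y \<otimes> inv v = (v \<otimes> g) \<otimes> x \<otimes> inv (v \<otimes> g)"
    using v g assms by (simp add: y_def conj_conj)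
  ultimately show ?thesis
    using v g by (intro bexI[of _ "v \<otimes> g"]) simp_all
qed

end

section \<open>Centralizers of elements that generate an invariant subgroup\<close>

context fpf_group
begin

text \<open>Since \<alpha> preserves orders, the last condition means that \<alpha> maps the cyclic
  group of \<open>y\<close> onto itself.\<close>

definition stable :: "'a \<Rightarrow> bool" where
  "stable y \<longleftrightarrow> y \<in> carrier G \<and> y \<noteq> \<one> \<and> \<alpha> y \<in> powers G y"

text \<open>\<alpha> maps the centralizer of \<open>y\<close> into that of
  \<open>\<alpha> y\<close>, and \<open>y\<close> is a power of \<open>\<alpha> y\<close> because
  the two have equal order.\<close>

lemma aut_centralizer:
  assumes "stable y"
  shows "\<alpha> ` centralizer y \<subseteq> centralizer y"
proof
  fix a assume "a \<in> \<alpha> ` centralizer y"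
  then obtain x where x: "x \<in> centralizer y" "a = \<alpha> x" by blast
  have y: "y \<in> carrier G" "\<alpha> y \<in> powers G y" using assms by (simp_all add: stable_def)
  have "y \<in> powers G (\<alpha> y)"
    using mem_powers_same_ord[OF finite_carrier y(1,2)] ord_aut y(1) by simp
  moreover have "\<alpha> x \<otimes> \<alpha> y = \<alpha> y \<otimes> \<alpha> x" "x \<in> carrier G"
    using x y by (auto simp: centralizer_def simp flip: aut_mult)
  ultimately show "a \<in> centralizer y"
    using mem_centralizer_powers[of "\<alpha> x" "\<alpha> y" y] y x by simp
qed

section \<open>The case without central stable elements\<close>

context
  assumes proper_cyclic: "\<And>M. subgroup M G \<Longrightarrow> M \<noteq> carrier G \<Longrightarrow> \<alpha> ` M \<subseteq> M \<Longrightarrow> \<exists>c\<in>M. M = powers G c"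
    and not_central: "\<And>y. stable y \<Longrightarrow> centralizer y \<noteq> carrier G"
begin

text \<open>Such a centralizer is a proper \<alpha>-invariant subgroup, so
  \<open>proper_cyclic\<close>, which the induction will supply, applies.\<close>

lemma centralizer_cyclic:
  assumes "stable y"
  shows "\<exists>c\<in>centralizer y. centralizer y = powers G c"
  using proper_cyclic[OF subgroup_centralizer not_central[OF assms] aut_centralizer[OF assms]] assms
  by (simp add: stable_def)

lemma centralizer_commute:
  assumes "stable y" "a \<in> centralizer y" "b \<in> centralizer y"
  shows "a \<otimes> b = b \<otimes> a"
proof -
  obtain c where "c \<in> centralizer y" "centralizer y = powers G c"
    using centralizer_cyclic[OF assms(1)] by blast
  then show ?thesis
    using powers_commute[of c a b] assms by (simp add: centralizer_def)
qed

text \<open>On the cyclic group \<open>centralizer y\<close> the map \<alpha> is a power map, so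
  each nontrivial \<open>w\<close> in it is stable. Then both centralizers are abelian and contain
  \<open>y\<close> and \<open>w\<close>, so each lies in the other.\<close>

lemma stable_centralizer:
  assumes "stable y" "w \<in> centralizer y" "w \<noteq> \<one>"
  shows "stable w" and "centralizer w = centralizer y"
proof -
  obtain c where c: "c \<in> centralizer y" "centralizer y = powers G c"
    using centralizer_cyclic[OF assms(1)] by blast
  have cc: "c \<in> carrier G" using c(1) by (simp add: centralizer_def)
  have "\<alpha> c \<in> powers G c" using aut_centralizer[OF assms(1)] c by blast
  then obtain j :: nat where j: "\<alpha> c = c [^] j" by (auto simp: powers_def)
  obtain k :: nat where k: "w = c [^] k" using assms(2) c(2) by (auto simp: powers_def)
  have "\<alpha> w = w [^] j"
    using cc by (simp add: k j aut_pow nat_pow_pow mult.commute)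
  then show w: "stable w"
    using assms by (simp add: stable_def pow_in_powers centralizer_def)
  have y: "y \<in> carrier G" using assms(1) by (simp add: stable_def)
  have "y \<in> centralizer w"
    using assms(2) y by (simp add: centralizer_def)
  then have "x \<in> centralizer y" if "x \<in> centralizer w" for x
    using centralizer_commute[OF w that] that by (simp add: centralizer_def)
  moreover have "x \<in> centralizer w" if "x \<in> centralizer y" for x
    using centralizer_commute[OF assms(1) that assms(2)] that by (simp add: centralizer_def)
  ultimately show "centralizer w = centralizer y" by blast
qed

text \<open>A conjugate of a stable element need not be stable; conjugating back by \<open>g\<close>
  reduces the claim to \<open>stable_centralizer\<close>.\<close>

lemma centralizer_conj_stable:
  assumes "stable y" "g \<in> carrier G" "w \<in> centralizer (g \<otimes> y \<otimes> inv g)" "w \<noteq> \<one>"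
  shows "centralizer w = centralizer (g \<otimes> y \<otimes> inv g)"
proof -
  let ?v = "inv g \<otimes> w \<otimes> g"
  have wc: "w \<in> carrier G" using assms(3) by (simp add: centralizer_def)
  have y: "y \<in> carrier G" using assms(1) by (simp add: stable_def)
  have w: "w = g \<otimes> ?v \<otimes> inv g" using wc assms(2) by simp
  have "?v \<in> centralizer y"
    using conj_mem_centralizer_iff[of g ?v y] assms(2,3) wc y w by simp
  moreover have "?v \<noteq> \<one>" using w assms(2,4) by auto
  ultimately have "centralizer ?v = centralizer y"
    using stable_centralizer assms(1) by blast
  then show ?thesis
    using conj_centralizer[of g ?v] conj_centralizer[of g y] assms(2) wc y by simp
qed

text \<open>If the centralizer \<open>M\<close> and its conjugate by \<open>g\<close> share a
  nontrivial element, they coincide, so \<open>g\<close> normalizes the cyclic group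
  \<open>M\<close>. Comparing the actions of \<open>g\<close> and \<open>\<alpha> g\<close> on a
  generator shows that \<open>inv g \<otimes> \<alpha> g\<close> lies in \<open>M\<close>, and the
  Lang map then puts \<open>g\<close> in \<open>M\<close>.\<close>

lemma frobenius_complement_centralizer:
  assumes "stable y"
  shows "frobenius_complement G (centralizer y)"
proof -
  let ?M = "centralizer y"
  have y: "y \<in> carrier G" "y \<noteq> \<one>" using assms(1) by (simp_all add: stable_def)
  have sub: "subgroup ?M G" using subgroup_centralizer[OF y(1)] .
  have yM: "y \<in> ?M" using self_in_centralizer[OF y(1)] .
  obtain c where c: "c \<in> ?M" "?M = powers G c"
    using centralizer_cyclic[OF assms] by blast
  have cc: "c \<in> carrier G" using c(1) by (simp add: centralizer_def)
  have "c \<noteq> \<one>"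
    using yM c(2) y(2) by (auto simp: powers_def)
  then have cent_c: "centralizer c = ?M" "stable c"
    using stable_centralizer[OF assms c(1)] by simp_all
  have mem: "g \<in> ?M" if g: "g \<in> carrier G" and w: "w \<in> ?M" "w \<in> g <# (?M #> inv g)" "w \<noteq> \<one>" for g w
  proof -
    have "?M = centralizer (g \<otimes> y \<otimes> inv g)"
      using stable_centralizer(2)[OF assms w(1,3)] centralizer_conj_stable[OF assms g _ w(3)] w(2)
        conj_centralizer[OF g y(1)] by simp
    then have "g \<otimes> c \<otimes> inv g \<in> powers G c"
      using conj_mem_centralizer_iff[OF g cc y(1)] c by simp
    then obtain b :: nat where b: "g \<otimes> c \<otimes> inv g = c [^] b" by (auto simp: powers_def)
    have "c \<in> powers G (\<alpha> c)"
      using mem_powers_same_ord[OF finite_carrier cc] cent_c(2) ord_aut[OF cc] by (simp add: stable_def)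
    then obtain j :: nat where j: "c = \<alpha> c [^] j" by (auto simp: powers_def)
    \<comment> \<open>Applying \<alpha> to \<open>g \<otimes> c \<otimes> inv g = c [^] b\<close>
      and raising to the \<open>j\<close>-th power, where \<open>c = \<alpha> c [^] j\<close>, shows
      that \<open>\<alpha> g\<close> also conjugates \<open>c\<close> to
      \<open>c [^] b\<close>.\<close>
    have "\<alpha> g \<otimes> \<alpha> c \<otimes> inv (\<alpha> g) = \<alpha> c [^] b"
      using b g cc by (simp flip: aut_conj aut_pow)
    then have "(\<alpha> g \<otimes> \<alpha> c \<otimes> inv (\<alpha> g)) [^] j = (\<alpha> c [^] j) [^] b"
      using cc by (simp add: nat_pow_pow mult.commute)
    then have "\<alpha> g \<otimes> c \<otimes> inv (\<alpha> g) = g \<otimes> c \<otimes> inv g"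
      using g cc b by (simp add: conj_pow flip: j)
    then have "inv g \<otimes> (\<alpha> g \<otimes> c \<otimes> inv (\<alpha> g)) \<otimes> inv (inv g) = c"
      using g cc by simp
    then have "(inv g \<otimes> \<alpha> g) \<otimes> c \<otimes> inv (inv g \<otimes> \<alpha> g) = c"
      using g cc by (simp only: conj_conj inv_closed aut_closed)
    then have "inv g \<otimes> \<alpha> g \<in> centralizer c"
      using conj_eq_iff_commute[of "inv g \<otimes> \<alpha> g" c] g cc by (simp add: centralizer_def)
    then have "inv g \<otimes> \<alpha> g \<in> ?M"
      by (simp only: cent_c(1))
    \<comment> \<open>Surjectivity on \<open>M\<close> yields \<open>n\<close> in \<open>M\<close>
      with the same Lang value as \<open>g\<close>, and injectivity on the whole group gives
      \<open>n = g\<close>.\<close>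
    then obtain n where "n \<in> ?M" "inv n \<otimes> \<alpha> n = inv g \<otimes> \<alpha> g"
      using lang_surj[OF sub aut_centralizer[OF assms]] by blast
    then show ?thesis
      using lang_inj[of n g] g by (simp add: centralizer_def)
  qed
  have "?M \<inter> (g <# (?M #> inv g)) = {\<one>}" if "g \<in> carrier G - ?M" for g
  proof -
    have "\<one> \<in> ?M" using subgroup.one_closed[OF sub] .
    moreover have "\<one> \<in> g <# (?M #> inv g)"
      using mem_conj_set_iff[OF subgroup.subset[OF sub], of g \<one>] that \<open>\<one> \<in> ?M\<close> by simp
    ultimately show ?thesis
      using mem[of g] that by blast
  qed
  moreover have "?M \<noteq> {\<one>}" using yM y(2) by blast
  ultimately show ?thesis
    using sub not_central[OF assms] is_group by (simp add: frobenius_complement_def)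
qed

text \<open>Every nontrivial element has a power with a stable conjugate. For stable
  \<open>y\<close> the conjugates of \<open>centralizer y\<close> cover more than half of the group
  but not all of it. An element outside them leads to a second stable \<open>y'\<close>, whose
  family also covers more than half, yet overlaps the first only in the identity.\<close>

lemma trivial_if_no_central_stable: "carrier G = {\<one>}"
proof (rule ccontr)
  assume "carrier G \<noteq> {\<one>}"
  have obt: "\<exists>u m. u \<in> carrier G \<and> stable (u \<otimes> x [^] (m::nat) \<otimes> inv u)" if x: "x \<in> carrier G" "x \<noteq> \<one>" for x
  proof -
    obtain q m :: nat where q: "Factorial_Ring.prime q" "x [^] m \<noteq> \<one>" "(x [^] m) [^] q = \<one>"
      using exists_prime_order_pow[OF finite_carrier x] by blast
    then obtain u where "u \<in> carrier G" "\<alpha> (u \<otimes> x [^] m \<otimes> inv u) \<in> powers G (u \<otimes> x [^] m \<otimes> inv u)"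
      using prime_order_conj_aut_invariant[of "x [^] m" q] x by auto
    then have "stable (u \<otimes> x [^] m \<otimes> inv u)"
      using q(2) x by (simp add: stable_def)
    then show ?thesis
      using \<open>u \<in> carrier G\<close> by blast
  qed
  let ?n = "order G"
  let ?C = "\<lambda>y. \<Union>g\<in>carrier G. g <# (centralizer y #> inv g)"
  let ?k = "\<lambda>y. card (frobenius_kernel G (centralizer y))"
  have C_iff: "w \<in> ?C y \<longleftrightarrow> (\<exists>g\<in>carrier G. w \<in> centralizer (g \<otimes> y \<otimes> inv g))" if "stable y" for y w
    using that conj_centralizer by (auto simp: stable_def)
  \<comment> \<open>\<open>2 * ?k y \<le> ?n\<close> holds because the centralizer contains
    \<open>\<one>\<close> and \<open>y\<close>; \<open>?k y \<ge> 2\<close> holds because it is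
    proper.\<close>
  have count: "card (?C y) + ?k y = ?n + 1" "2 * ?k y \<le> ?n" "?k y \<ge> 2" if y: "stable y" for y
  proof -
    have fr: "frobenius_complement G (centralizer y)"
      using frobenius_complement_centralizer[OF y] .
    have sub: "subgroup (centralizer y) G" "centralizer y \<noteq> carrier G"
      using fr by (simp_all add: frobenius_complement_def)
    have fin: "finite (centralizer y)"
      using subgroup.subset[OF sub(1)] finite_carrier finite_subset by blast
    show "card (?C y) + ?k y = ?n + 1"
      using card_frobenius_kernel(3)[OF finite_carrier fr] .
    have prod: "?k y * card (centralizer y) = ?n"
      using card_frobenius_kernel(2)[OF finite_carrier fr] .
    have "card {\<one>, y} \<le> card (centralizer y)"
      using subgroup.one_closed[OF sub(1)] self_in_centralizer y fin
      by (intro card_mono) (auto simp: stable_def)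
    moreover have "card {\<one>, y} = 2"
      using y by (auto simp: stable_def card_insert_if)
    ultimately have "2 \<le> card (centralizer y)"
      by simp
    then have "?k y * 2 \<le> ?k y * card (centralizer y)"
      by (rule mult_le_mono2)
    then show "2 * ?k y \<le> ?n"
      unfolding prod by simp
    have "card (centralizer y) < ?n"
      unfolding order_def using subgroup.subset[OF sub(1)] sub(2) finite_carrier by (intro psubset_card_mono) auto
    then have "?k y \<noteq> 0" "?k y \<noteq> 1"
      using prod by (metis mult_0 not_less_zero) (metis mult_1 nat_neq_iff prod \<open>card (centralizer y) < ?n\<close>)
    then show "?k y \<ge> 2" by linarith
  qed
  obtain x0 where "x0 \<in> carrier G" "x0 \<noteq> \<one>"
    using \<open>carrier G \<noteq> {\<one>}\<close> one_closed by blast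
  then obtain y where y: "stable y" using obt by blast
  have yc: "y \<in> carrier G" using y by (simp add: stable_def)
  have "card (?C y) < ?n"
    using count[OF y] by linarith
  then have "\<not> carrier G \<subseteq> ?C y"
    using card_mono[of "?C y" "carrier G"] y yc finite_carrier
    by (metis (no_types, lifting) C_iff card_ge_0_finite centralizer_def finite_subset leD mem_Collect_eq order_def subsetI)
  then obtain x where x: "x \<in> carrier G" "x \<notin> ?C y" by blast
  have "\<one> \<in> ?C y"
    using C_iff[OF y, of \<one>] yc by (auto simp: centralizer_def)
  then have "x \<noteq> \<one>" using x by metis
  then obtain u m where u: "u \<in> carrier G" "stable (u \<otimes> x [^] (m::nat) \<otimes> inv u)"
    using obt x(1) by blast
  define y' where "y' = u \<otimes> x [^] m \<otimes> inv u"
  have y': "stable y'" using u by (simp add: y'_def)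
  have y'c: "y' \<in> carrier G" using y' by (simp add: stable_def)
  have xm: "x [^] m \<noteq> \<one>"
    using u x(1) by (auto simp: stable_def)
  \<comment> \<open>A common nontrivial element would make a conjugate of
    \<open>centralizer y'\<close> equal to a conjugate of \<open>centralizer y\<close>. Conjugating
    back, some conjugate of \<open>centralizer y\<close> is the centralizer of
    \<open>x [^] m\<close> and so contains \<open>x\<close>, against the choice of
    \<open>x\<close>.\<close>
  have disj: "w = \<one>" if wC: "w \<in> ?C y" "w \<in> ?C y'" for w
  proof (rule ccontr)
    assume "w \<noteq> \<one>"
    obtain g where g: "g \<in> carrier G" "w \<in> centralizer (g \<otimes> y \<otimes> inv g)"
      using wC(1) C_iff[OF y] by blast
    obtain h where h: "h \<in> carrier G" "w \<in> centralizer (h \<otimes> y' \<otimes> inv h)"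
      using wC(2) C_iff[OF y'] by blast
    have "centralizer (g \<otimes> y \<otimes> inv g) = centralizer (h \<otimes> y' \<otimes> inv h)"
      using centralizer_conj_stable[OF y g \<open>w \<noteq> \<one>\<close>] centralizer_conj_stable[OF y' h \<open>w \<noteq> \<one>\<close>] by simp
    then have "h \<otimes> y' \<otimes> inv h \<in> centralizer (g \<otimes> y \<otimes> inv g)"
      using self_in_centralizer[of "h \<otimes> y' \<otimes> inv h"] h(1) y'c by simp
    then have *: "(h \<otimes> u) \<otimes> x [^] m \<otimes> inv (h \<otimes> u) \<in> centralizer (g \<otimes> y \<otimes> inv g)"
      using conj_conj[of h u "x [^] m"] h(1) u(1) x(1) by (simp add: y'_def)
    let ?k = "h \<otimes> u" and ?l = "inv (h \<otimes> u) \<otimes> g"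
    have k: "?k \<in> carrier G" "?l \<in> carrier G" using h u g by simp_all
    have "g \<otimes> y \<otimes> inv g = ?k \<otimes> (?l \<otimes> y \<otimes> inv ?l) \<otimes> inv ?k"
    proof -
      have "?k \<otimes> ?l = g" using k(1) g(1) by (simp flip: m_assoc)
      then show ?thesis using conj_conj[OF k yc] by simp
    qed
    then have xC: "x [^] m \<in> centralizer (?l \<otimes> y \<otimes> inv ?l)"
      using * conj_mem_centralizer_iff[OF k(1), of "x [^] m" "?l \<otimes> y \<otimes> inv ?l"] k yc x(1) by simp
    have "x \<in> centralizer (x [^] m)"
      using mem_centralizer_powers[OF x(1) x(1) refl pow_in_powers] .
    then have "x \<in> centralizer (?l \<otimes> y \<otimes> inv ?l)"
      using centralizer_conj_stable[OF y k(2) xC xm] by simp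
    then show False
      using x(2) C_iff[OF y] k(2) by blast
  qed
  have "?C y' \<subseteq> frobenius_kernel G (centralizer y)"
  proof
    fix w assume w: "w \<in> ?C y'"
    then have "w \<in> carrier G"
      using C_iff[OF y'] by (auto simp: centralizer_def)
    then show "w \<in> frobenius_kernel G (centralizer y)"
      using disj[OF _ w] unfolding frobenius_kernel_def by blast
  qed
  moreover have "finite (frobenius_kernel G (centralizer y))"
    using finite_carrier by (simp add: frobenius_kernel_def)
  ultimately have "card (?C y') \<le> ?k y"
    by (rule card_mono[rotated])
  \<comment> \<open>As \<open>?k y\<close> and \<open>?k y'\<close> are at most half of
    \<open>?n\<close>, the inclusion would give
    \<open>?n + 1 \<le> ?k y + ?k y' \<le> ?n\<close>.\<close>
  then show False
    using count[OF y] count[OF y'] by linarith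
qed

end

end

section \<open>Powers of a product with central commutator\<close>

context group
begin

text \<open>\<open>c\<close> is the commutator of \<open>x\<close> and \<open>y\<close>. Moving
  \<open>y\<close> past \<open>x [^] n\<close> costs \<open>c [^] n\<close>, and these exponents add
  up to a binomial coefficient. The use is for an odd prime \<open>q\<close>, which divides
  \<open>q choose 2\<close>.\<close>

lemma pow_mult_quasi_commute:
  fixes n :: nat
  assumes "x \<in> carrier G" "y \<in> carrier G" "c \<in> carrier G"
    and xy: "x \<otimes> y = c \<otimes> (y \<otimes> x)"
    and c: "\<And>a. a \<in> carrier G \<Longrightarrow> a \<otimes> c = c \<otimes> a"
  shows "x [^] n \<otimes> y = c [^] n \<otimes> (y \<otimes> x [^] n)"
    and "(y \<otimes> x) [^] n = c [^] (n choose 2) \<otimes> (y [^] n \<otimes> x [^] n)"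
proof -
  have cn: "a \<otimes> c [^] (k::nat) = c [^] k \<otimes> a" if "a \<in> carrier G" for a k
    using group_commutes_pow[of c a k] c[OF that] assms(3) that by simp
  have 1: "x [^] n \<otimes> y = c [^] n \<otimes> (y \<otimes> x [^] n)" for n :: nat
  proof (induction n)
    case (Suc n)
    have "x [^] Suc n \<otimes> y = x [^] n \<otimes> (x \<otimes> y)"
      using assms(1-3) by (simp add: m_assoc)
    also have "\<dots> = x [^] n \<otimes> c \<otimes> (y \<otimes> x)"
      using assms(1-3) by (simp add: xy m_assoc)
    also have "x [^] n \<otimes> c = c \<otimes> x [^] n"
      using c assms(1) by simp
    also have "c \<otimes> x [^] n \<otimes> (y \<otimes> x) = c \<otimes> (x [^] n \<otimes> y) \<otimes> x"
      using assms by (simp add: m_assoc)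
    also have "\<dots> = c \<otimes> c [^] n \<otimes> (y \<otimes> (x [^] n \<otimes> x))"
      using assms by (simp add: Suc m_assoc)
    also have "\<dots> = c [^] Suc n \<otimes> (y \<otimes> x [^] Suc n)"
      using assms by (simp add: c)
    finally show ?case .
  qed (use assms in simp)
  then show "x [^] n \<otimes> y = c [^] n \<otimes> (y \<otimes> x [^] n)" .
  show "(y \<otimes> x) [^] n = c [^] (n choose 2) \<otimes> (y [^] n \<otimes> x [^] n)"
  proof (induction n)
    case (Suc n)
    let ?t = "n choose 2"
    have "(y \<otimes> x) [^] Suc n = c [^] ?t \<otimes> (y [^] n \<otimes> (x [^] n \<otimes> y) \<otimes> x)"
      using assms(1-3) by (simp add: Suc m_assoc)
    also have "\<dots> = c [^] ?t \<otimes> ((y [^] n \<otimes> c [^] n) \<otimes> (y \<otimes> (x [^] n \<otimes> x)))"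
      using assms(1-3) by (simp add: 1 m_assoc)
    also have "y [^] n \<otimes> c [^] n = c [^] n \<otimes> y [^] n"
      using cn assms(2) by simp
    also have "c [^] ?t \<otimes> ((c [^] n \<otimes> y [^] n) \<otimes> (y \<otimes> (x [^] n \<otimes> x)))
        = (c [^] ?t \<otimes> c [^] n) \<otimes> ((y [^] n \<otimes> y) \<otimes> (x [^] n \<otimes> x))"
      using assms(1-3) by (simp add: m_assoc)
    also have "\<dots> = c [^] (Suc n choose 2) \<otimes> (y [^] Suc n \<otimes> x [^] Suc n)"
      using assms(1-3) by (simp add: nat_pow_mult numeral_2_eq_2 add.commute)
    finally show ?case .
  qed (use assms in \<open>simp add: numeral_2_eq_2\<close>)
qed

end

section \<open>The case of a central stable element: the quotient by a central subgroup of prime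
  order\<close>

context fpf_group
begin

context
  fixes z and q :: nat
  assumes z: "z \<in> carrier G" "z \<noteq> \<one>" "z [^] q = \<one>" and q: "Factorial_Ring.prime q"
    and z_stable: "\<alpha> z \<in> powers G z"
    and z_central: "\<And>x. x \<in> carrier G \<Longrightarrow> x \<otimes> z = z \<otimes> x"
begin

abbreviation (input) "P \<equiv> powers G z"

lemma ord_z: "ord z = q"
  using ord_prime z q by blast

lemma P_closed: "e \<in> P \<Longrightarrow> e \<in> carrier G"
  using powers_in_carrier z(1) by blast

lemma P_central: "e \<in> P \<Longrightarrow> x \<in> carrier G \<Longrightarrow> x \<otimes> e = e \<otimes> x"
  using group_commutes_pow[of z x] z_central[of x] z(1) by (auto simp: powers_def)

lemma P_pow: "e \<in> P \<Longrightarrow> e [^] q = \<one>"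
  using powers_pow_prime z by blast

lemma P_subgroup: "subgroup P G"
  using subgroup_powers finite_carrier z(1) by blast

lemma P_normal: "P \<lhd> G"
  using P_subgroup
proof (rule normal_invI)
  fix x h assume "x \<in> carrier G" "h \<in> P"
  then show "x \<otimes> h \<otimes> inv x \<in> P"
    using P_central P_closed by (simp add: m_assoc)
qed

text \<open>A group of order two has only one nontrivial element, which \<alpha> would have to
  fix.\<close>

lemma odd_q: "2 < q"
proof -
  have "q \<noteq> 2"
  proof
    assume "q = 2"
    then have zz: "z \<otimes> z = \<one>" using z by (simp add: numeral_2_eq_2)
    have "z [^] (n::nat) = \<one> \<or> z [^] n = z" for n
      by (induction n) (use z zz in auto)
    moreover obtain k :: nat where "\<alpha> z = z [^] k" using z_stable by (auto simp: powers_def)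
    ultimately have "\<alpha> z = \<one> \<or> \<alpha> z = z" by metis
    then show False using aut_eq_one fpf z by blast
  qed
  then show ?thesis using prime_ge_2_nat[OF q] by simp
qed

lemma aut_P: "\<alpha> ` P \<subseteq> P"
  using aut_powers[OF z(1)] powers_trans[OF z(1) z_stable] by blast

text \<open>Modulo \<open>P\<close> the rank stays at most one. This needs \<open>odd_q\<close>: the quotient of the quaternion group by
  its center has rank two.\<close>
lemma rank_le_one_mod_center:
  fixes r :: nat
  assumes r: "Factorial_Ring.prime r" and x: "x \<in> carrier G" and y: "y \<in> carrier G"
    and xr: "x [^] r \<in> P" and yr: "y [^] r \<in> P"
    and c: "(x \<otimes> y) \<otimes> inv (y \<otimes> x) \<in> P" and xP: "x \<notin> P"
  shows "\<exists>i::nat. y \<otimes> inv (x [^] i) \<in> P"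
proof -
  define c where "c = (x \<otimes> y) \<otimes> inv (y \<otimes> x)"
  have cP: "c \<in> P" using c by (simp add: c_def)
  note cc = P_closed[OF cP]
  have ccomm: "a \<otimes> c = c \<otimes> a" if "a \<in> carrier G" for a using P_central cP that by blast
  have xy: "x \<otimes> y = c \<otimes> (y \<otimes> x)"
    using x y by (simp add: c_def m_assoc)
  show ?thesis
  proof (cases "r = q")
    \<comment> \<open>As \<open>x\<close> is outside \<open>P\<close>, its \<open>q\<close>-th power
      generates \<open>P\<close>, and some \<open>i\<close> makes
      \<open>y [^] q \<otimes> (x [^] i) [^] q\<close> trivial. The commutator enters with exponent
      \<open>q choose 2\<close>, a multiple of \<open>q\<close>, so
      \<open>y \<otimes> x [^] i\<close> has trivial \<open>q\<close>-th power and lies in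
      \<open>P\<close> by the rank condition.\<close>
    case True
    have "x [^] q \<noteq> \<one>"
    proof
      assume "x [^] q = \<one>"
      then have "x \<in> P"
        using rank_le_oneD[OF rank q z(1) x] z z_central[OF x] by simp
      then show False using xP by simp
    qed
    then have "z \<in> powers G (x [^] q)"
      using mem_powers_prime[OF z(1,3) q] xr True by blast
    moreover have "inv (y [^] q) \<in> P"
      using yr True subgroup.m_inv_closed[OF P_subgroup] by blast
    ultimately have "inv (y [^] q) \<in> powers G (x [^] q)"
      using powers_trans[of "x [^] q" z] x by simp
    then obtain i :: nat where "inv (y [^] q) = (x [^] q) [^] i"
      by (auto simp: powers_def)
    then have i: "y [^] q \<otimes> (x [^] i) [^] q = \<one>"
      using x y by (metis mult.commute nat_pow_closed nat_pow_pow r_inv)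
    have xiy: "x [^] i \<otimes> y = c [^] i \<otimes> (y \<otimes> x [^] i)"
      using pow_mult_quasi_commute(1)[OF x y cc xy ccomm] .
    have ci: "c [^] i \<in> P"
      using subgroup_pow_closed[OF P_subgroup cP] .
    have "q dvd (q choose 2)"
      using odd_q dvd_choose_prime[of 2 q] q by simp
    then have "(c [^] i) [^] (q choose 2) = \<one>"
      using P_pow[OF ci] P_closed[OF ci] by (metis dvdE nat_pow_one nat_pow_pow)
    then have "(y \<otimes> x [^] i) [^] q = \<one>"
      using pow_mult_quasi_commute(2)[OF _ y P_closed[OF ci] xiy P_central[OF ci], of q] x y i by simp
    then have yx: "y \<otimes> x [^] i \<in> P"
      using rank_le_oneD[OF rank q z(1), of "y \<otimes> x [^] i"] z z_central x y by simp
    \<comment> \<open>The conclusion asks for an inverse power: since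
      \<open>x [^] (q * q) = \<one>\<close>, \<open>x [^] i\<close> is the inverse of another
      natural power of \<open>x\<close>.\<close>
    have "(x [^] q) [^] q = \<one>" using P_pow xr True by blast
    then have xqq: "x [^] (q * q) = \<one>"
      using x by (simp add: nat_pow_pow)
    have "i + i * (q * q - 1) = (q * q) * i"
      using odd_q by (simp add: algebra_simps)
    then have "x [^] i \<otimes> x [^] (i * (q * q - 1)) = (x [^] (q * q)) [^] i"
      using x by (simp add: nat_pow_mult nat_pow_pow)
    then have "x [^] i = inv (x [^] (i * (q * q - 1)))"
      using x xqq by (simp add: inv_equality[symmetric])
    then show ?thesis using yx by metis
  next
    case False
    \<comment> \<open>For \<open>r \<noteq> q\<close> every element of \<open>P\<close> is an
      \<open>r\<close>-th power in \<open>P\<close>, so \<open>x\<close> and \<open>y\<close> can be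
      corrected by central factors to have trivial \<open>r\<close>-th powers in
      \<open>G\<close>.\<close>
    have root: "\<exists>e\<in>P. (w \<otimes> e) [^] r = \<one>" if w: "w \<in> carrier G" "w [^] r \<in> P" for w
    proof -
      have "coprime r (ord z)"
        unfolding ord_z using primes_coprime[OF r q False] .
      then have "z \<in> powers G (z [^] r)"
        using mem_powers_coprime z(1) by blast
      moreover have "inv (w [^] r) \<in> P"
        using w(2) subgroup.m_inv_closed[OF P_subgroup] by blast
      ultimately have "inv (w [^] r) \<in> powers G (z [^] r)"
        using powers_trans[of "z [^] r" z] z by simp
      then obtain i :: nat where i: "inv (w [^] r) = (z [^] r) [^] i"
        by (auto simp: powers_def)
      have "(w \<otimes> z [^] i) [^] r = w [^] r \<otimes> (z [^] i) [^] r"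
        using P_central[OF pow_in_powers w(1)] w z by (intro pow_mult_distrib) simp_all
      also have "(z [^] i) [^] r = inv (w [^] r)"
        using z by (simp add: i nat_pow_pow mult.commute)
      finally show ?thesis using w pow_in_powers[of z i] by force
    qed
    obtain d where d: "d \<in> P" "(x \<otimes> d) [^] r = \<one>" using root x xr by blast
    obtain e where e: "e \<in> P" "(y \<otimes> e) [^] r = \<one>" using root y yr by blast
    let ?x = "x \<otimes> d" and ?y = "y \<otimes> e"
    note dc = P_closed[OF d(1)] and ec = P_closed[OF e(1)]
    have cl: "?x \<in> carrier G" "?y \<in> carrier G" using x y dc ec by simp_all
    have comm4: "(a \<otimes> d) \<otimes> (b \<otimes> e) = (a \<otimes> b) \<otimes> (d \<otimes> e)" "(b \<otimes> e) \<otimes> (a \<otimes> d) = (b \<otimes> a) \<otimes> (d \<otimes> e)"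
      if "a \<in> carrier G" "b \<in> carrier G" for a b
    proof -
      have "d \<otimes> (b \<otimes> e) = b \<otimes> (d \<otimes> e)"
        using that dc ec P_central[OF d(1) that(2)] by (simp flip: m_assoc)
      then show "(a \<otimes> d) \<otimes> (b \<otimes> e) = (a \<otimes> b) \<otimes> (d \<otimes> e)"
        using that dc ec by (simp add: m_assoc)
      have "e \<otimes> (a \<otimes> d) = a \<otimes> (d \<otimes> e)"
        using that dc ec P_central[OF e(1), of "a \<otimes> d"] by (simp add: m_assoc)
      then show "(b \<otimes> e) \<otimes> (a \<otimes> d) = (b \<otimes> a) \<otimes> (d \<otimes> e)"
        using that dc ec by (simp add: m_assoc)
    qed
    have xy': "?x \<otimes> ?y = c \<otimes> (?y \<otimes> ?x)"
      using comm4[OF x y] x y dc ec cc by (simp add: xy m_assoc)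
    \<comment> \<open>The commutator of the corrected elements is still \<open>c\<close>. Its order
      divides both \<open>r\<close> and \<open>q\<close>, so they commute and the rank condition of
      \<open>G\<close> applies.\<close>
    have "?y = c [^] r \<otimes> ?y"
      using pow_mult_quasi_commute(1)[OF cl cc xy' ccomm, of r] d(2) cl cc by simp
    then have "c [^] r = \<one>"
      using cl cc by (metis nat_pow_closed r_cancel_one')
    then have "ord c dvd r" "ord c dvd q"
      using pow_eq_id[OF cc] P_pow[OF cP] by auto
    then have "ord c = 1"
      using primes_coprime[OF r q False] coprime_common_divisor_nat by blast
    then have "c = \<one>" using ord_eq_1 cc by blast
    then have "?x \<otimes> ?y = ?y \<otimes> ?x" using xy' cl by simp
    moreover have "?x \<noteq> \<one>"
    proof
      assume "?x = \<one>"
      then have "x = inv d" using x dc by (metis inv_equality)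
      then show False using xP subgroup.m_inv_closed[OF P_subgroup d(1)] by simp
    qed
    ultimately have "?y \<in> powers G ?x"
      using rank_le_oneD[OF rank r cl] d e by blast
    then obtain i :: nat where i: "?y = ?x [^] i" by (auto simp: powers_def)
    have "?x [^] i = x [^] i \<otimes> d [^] i"
      using P_central[OF d(1) x] x dc by (intro pow_mult_distrib) simp_all
    also have "\<dots> = d [^] i \<otimes> x [^] i"
      using P_central[OF subgroup_pow_closed[OF P_subgroup d(1)]] x by simp
    finally have "e \<otimes> y = d [^] i \<otimes> x [^] i"
      using i P_central[OF e(1) y] by simp
    then have "y \<otimes> inv (x [^] i) = inv e \<otimes> d [^] i"
      using x y dc ec by (metis inv_closed inv_solve_left inv_solve_right m_assoc m_closed nat_pow_closed)
    moreover have "inv e \<otimes> d [^] i \<in> P"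
      using subgroup.m_closed[OF P_subgroup subgroup.m_inv_closed[OF P_subgroup e(1)]
          subgroup_pow_closed[OF P_subgroup d(1)]] .
    ultimately show ?thesis by metis
  qed
qed

text \<open>If \<open>z\<close> is not already a power of \<open>a\<close>, then \<open>q\<close>
  does not divide \<open>ord a\<close>: otherwise a power of \<open>a\<close> would have order
  \<open>q\<close> and generate \<open>P\<close> by the rank condition. Then
  \<open>(a \<otimes> z) [^] q = a [^] q\<close> generates the same group as \<open>a\<close>, so
  \<open>a\<close> and \<open>z\<close> are both powers of \<open>a \<otimes> z\<close>.\<close>

lemma cyclic_if_cyclic_mod_center:
  assumes a: "a \<in> carrier G" and gen: "\<And>x. x \<in> carrier G \<Longrightarrow> \<exists>i::nat. x \<otimes> inv (a [^] i) \<in> P"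
  shows "\<exists>c\<in>carrier G. carrier G = powers G c"
proof -
  have carrier: "carrier G = powers G b" if b: "b \<in> carrier G" "a \<in> powers G b" "z \<in> powers G b" for b
  proof
    show "carrier G \<subseteq> powers G b"
    proof
      fix x assume x: "x \<in> carrier G"
      then obtain i :: nat where i: "x \<otimes> inv (a [^] i) \<in> P" using gen by blast
      then have "x \<otimes> inv (a [^] i) \<in> powers G b"
        using powers_trans b(1,3) by blast
      moreover have "a [^] i \<in> powers G b"
        using powers_trans[OF b(1,2) pow_in_powers] .
      ultimately have "x \<otimes> inv (a [^] i) \<otimes> a [^] i \<in> powers G b"
        using powers_mult b(1) by blast
      then show "x \<in> powers G b"
        using x a by (simp add: m_assoc)
    qed
  qed (use powers_in_carrier b in blast)
  show ?thesis
  proof (cases "z \<in> powers G a")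
    case True
    then show ?thesis using carrier[OF a self_in_powers[OF a]] a by blast
  next
    case False
    have "\<not> q dvd ord a"
    proof
      assume "q dvd ord a"
      then obtain m where m: "ord a = q * m" by (elim dvdE)
      have "ord a > 0" using ord_ge_1[OF finite_carrier a] by simp
      then have "\<not> ord a dvd m"
        using m odd_q by (auto dest!: dvd_imp_le)
      then have "a [^] m \<noteq> \<one>"
        using a by (simp add: pow_eq_id)
      moreover have "(a [^] m) [^] q = \<one>"
        using a m by (simp add: nat_pow_pow mult.commute pow_eq_id)
      ultimately have "z \<in> powers G (a [^] m)"
        using rank_le_oneD[OF rank q _ z(1), of "a [^] m"] a z z_central by simp
      then show False
        using False powers_trans[OF a pow_in_powers] by blast
    qed
    then have "coprime q (ord a)"
      using q prime_imp_coprime by blast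
    then have aq: "a \<in> powers G (a [^] q)"
      using mem_powers_coprime a by blast
    define b where "b = a \<otimes> z"
    have b: "b \<in> carrier G" using a z by (simp add: b_def)
    have "b [^] q = a [^] q \<otimes> z [^] q"
      unfolding b_def using a z z_central by (intro pow_mult_distrib) simp_all
    then have "a [^] q \<in> powers G b"
      using a z pow_in_powers[of b q] by simp
    then have ab: "a \<in> powers G b"
      using powers_trans b aq by blast
    have "inv a \<otimes> b \<in> powers G b"
      using subgroup.m_closed[OF subgroup_powers[OF finite_carrier b]
          subgroup.m_inv_closed[OF subgroup_powers[OF finite_carrier b] ab] self_in_powers[OF b]] .
    then have "z \<in> powers G b"
      using a z by (simp add: b_def flip: m_assoc)
    then show ?thesis using carrier[OF b ab] b by blast
  qed
qed

text \<open>The quotient by \<open>P\<close> inherits a fixed-point-free automorphism and the rank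
  condition, so it is cyclic by induction, and \<open>cyclic_if_cyclic_mod_center\<close> lifts this
  to \<open>G\<close>.\<close>

lemma cyclic_by_central_quotient:
  assumes IH: "\<And>(Q :: 'a monoid) \<beta>. fpf_group Q \<beta> \<Longrightarrow> card (carrier Q) < card (carrier G) \<Longrightarrow>
      \<exists>c\<in>carrier Q. carrier Q = powers Q c"
  shows "\<exists>c\<in>carrier G. carrier G = powers G c"
proof -
  \<comment> \<open>\<open>f\<close> picks a representative of each coset of \<open>P\<close>. The
    quotient is thus realized on elements of type \<open>'a\<close>, as the induction hypothesis
    demands, rather than on sets of them.\<close>
  define f where "f a = (SOME b. b \<in> P #> a)" for a
  have fP: "f a \<in> P #> a" if "a \<in> carrier G" for a
    unfolding f_def using rcos_self[OF that P_subgroup] by (rule someI)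
  have f_eq: "f a = f b \<longleftrightarrow> a \<otimes> inv b \<in> P" if "a \<in> carrier G" "b \<in> carrier G" for a b
  proof
    assume "f a = f b"
    then have "f a \<in> P #> a" "f a \<in> P #> b" using fP that by metis+
    then have "P #> a = P #> b"
      using repr_independence[OF _ _ P_subgroup] that by metis
    then have "a \<in> P #> b" using rcos_self[OF that(1) P_subgroup] by simp
    then show "a \<otimes> inv b \<in> P"
      using subgroup.rcos_module[OF P_subgroup is_group] that by blast
  next
    assume "a \<otimes> inv b \<in> P"
    then have "a \<in> P #> b"
      using subgroup.rcos_module[OF P_subgroup is_group] that by blast
    then have "P #> b = P #> a"
      using repr_independence[OF _ _ P_subgroup] that by metis
    then show "f a = f b" by (simp add: f_def)
  qed
  have fc: "f a \<in> carrier G" "f a \<otimes> inv a \<in> P" if "a \<in> carrier G" for a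
    using fP[OF that] r_coset_subset_G[of P a] powers_in_carrier[OF z(1)] that
      subgroup.rcos_module[OF P_subgroup is_group that] by blast+
  define Q where "Q = image_group f G"
  have weak: "weak_group_morphism f P G"
    by (rule weak_group_morphismsI[OF P_normal f_eq])
  interpret Q: group Q
    unfolding Q_def using image_group_is_group[OF weak] .
  have fhom: "f \<in> hom G Q"
    unfolding Q_def using weak_group_morphism_is_hom[OF weak] .
  interpret f: group_hom G Q f
    by unfold_locales (rule fhom)
  have Qc: "carrier Q = f ` carrier G"
    by (simp add: Q_def image_group_carrier)
  have f_one: "f a = \<one>\<^bsub>Q\<^esub> \<longleftrightarrow> a \<in> P" if "a \<in> carrier G" for a
    using f_eq[OF that one_closed] that by simp
  define \<beta> where "\<beta> = (\<lambda>b. f (\<alpha> b))"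
  have \<beta>: "\<beta> (f a) = f (\<alpha> a)" if a: "a \<in> carrier G" for a
  proof -
    have "\<alpha> (f a) \<otimes> inv (\<alpha> a) = \<alpha> (f a \<otimes> inv a)"
      using a fc by (simp add: aut_mult aut_inv)
    then have "\<alpha> (f a) \<otimes> inv (\<alpha> a) \<in> P"
      using fc[OF a] aut_P by auto
    then show ?thesis using f_eq a fc by (simp add: \<beta>_def)
  qed
  have finQ: "finite (carrier Q)" using Qc finite_carrier by simp
  have "fpf_group Q \<beta>"
  proof unfold_locales
    show "finite (carrier Q)" by fact
    have "\<beta> ` carrier Q = carrier Q"
    proof -
      have "\<alpha> ` carrier G = carrier G" using iso by (simp add: iso_def bij_betw_def)
      then show ?thesis using \<beta> unfolding Qc by (force simp: image_image)
    qed
    moreover from this have "inj_on \<beta> (carrier Q)"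
      using finQ by (intro eq_card_imp_inj_on) auto
    moreover have "\<beta> \<in> hom Q Q"
    proof (rule homI)
      fix a b assume "a \<in> carrier Q" "b \<in> carrier Q"
      then obtain x y where xy: "x \<in> carrier G" "y \<in> carrier G" "a = f x" "b = f y"
        unfolding Qc by blast
      then show "\<beta> (a \<otimes>\<^bsub>Q\<^esub> b) = \<beta> a \<otimes>\<^bsub>Q\<^esub> \<beta> b"
        using \<beta>[of "x \<otimes> y"] \<beta>[of x] \<beta>[of y] by (simp add: aut_mult)
    qed (use calculation in blast)
    ultimately show "\<beta> \<in> iso Q Q"
      by (simp add: iso_def bij_betw_def)
  next
    fix b assume "b \<in> carrier Q" "\<beta> b = b"
    then obtain x where x: "x \<in> carrier G" "b = f x" "f (\<alpha> x) = f x"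
      using \<beta> unfolding Qc by auto
    then have n: "\<alpha> x \<otimes> inv x \<in> P"
      using f_eq by simp
    \<comment> \<open>\<open>m\<close> solves the Lang equation inside the central subgroup
      \<open>P\<close>, so that \<open>inv m \<otimes> x\<close>, an element of the coset of
      \<open>x\<close>, is fixed by \<alpha> and hence trivial.\<close>
    obtain m where m: "m \<in> P" "inv m \<otimes> \<alpha> m = \<alpha> x \<otimes> inv x"
      using lang_surj[OF P_subgroup aut_P n] by blast
    note mc = P_closed[OF m(1)]
    have "\<alpha> m = m \<otimes> (\<alpha> x \<otimes> inv x)"
      using m(2) mc x(1) by (metis aut_closed inv_closed inv_solve_left m_closed)
    also have "\<dots> = (\<alpha> x \<otimes> inv x) \<otimes> m"
      using P_central[OF n mc] .
    finally have *: "\<alpha> m = (\<alpha> x \<otimes> inv x) \<otimes> m" .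
    have "\<alpha> (inv m \<otimes> x) = inv (\<alpha> m) \<otimes> \<alpha> x"
      using mc x(1) by (simp add: aut_mult aut_inv)
    also have "\<dots> = inv m \<otimes> (x \<otimes> inv (\<alpha> x) \<otimes> \<alpha> x)"
      unfolding * using mc x(1) by (simp add: inv_mult_group m_assoc)
    finally have "\<alpha> (inv m \<otimes> x) = inv m \<otimes> x"
      using mc x(1) by (simp add: m_assoc)
    then have "inv m \<otimes> x = \<one>"
      using fpf mc x(1) by simp
    then have "x = m"
      using mc x(1) by (metis inv_equality inv_inv inv_closed inv_solve_left r_one)
    then show "b = \<one>\<^bsub>Q\<^esub>"
      using f_one x m by simp
  next
    show "rank_le_one Q"
      unfolding rank_le_one_def
    proof (intro allI impI)
      fix r :: nat and a b
      assume r: "Factorial_Ring.prime r" and ab: "a \<in> carrier Q" "b \<in> carrier Q" "a \<otimes>\<^bsub>Q\<^esub> b = b \<otimes>\<^bsub>Q\<^esub> a"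
        "a [^]\<^bsub>Q\<^esub> r = \<one>\<^bsub>Q\<^esub>" "b [^]\<^bsub>Q\<^esub> r = \<one>\<^bsub>Q\<^esub>" "a \<noteq> \<one>\<^bsub>Q\<^esub>"
      obtain x y where xy: "x \<in> carrier G" "y \<in> carrier G" "a = f x" "b = f y"
        using ab unfolding Qc by blast
      have "x [^] r \<in> P" "y [^] r \<in> P"
        using ab(4,5) xy f_one by (simp_all flip: f.hom_nat_pow)
      moreover have "x \<otimes> y \<otimes> inv (y \<otimes> x) \<in> P"
        using ab(3) xy f_eq[of "x \<otimes> y" "y \<otimes> x"] by simp
      moreover have "x \<notin> P" using ab(6) xy f_one by simp
      ultimately obtain i :: nat where "y \<otimes> inv (x [^] i) \<in> P"
        using rank_le_one_mod_center[OF r xy(1,2)] by blast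
      then have "f y = f (x [^] i)" using f_eq xy by simp
      then have "b = a [^]\<^bsub>Q\<^esub> i" using xy f.hom_nat_pow by simp
      then show "b \<in> powers Q a" using Q.pow_in_powers by simp
    qed
  qed
  moreover have "card (carrier Q) < card (carrier G)"
  proof (rule ccontr)
    assume "\<not> ?thesis"
    then have "inj_on f (carrier G)"
      unfolding Qc using finite_carrier card_image_le[of "carrier G" f] by (intro eq_card_imp_inj_on) simp_all
    moreover have "f z = f \<one>"
      using f_one[OF z(1)] self_in_powers[OF z(1)] by simp
    ultimately show False using z by (meson inj_onD one_closed)
  qed
  ultimately obtain b where b: "b \<in> carrier Q" "carrier Q = powers Q b"
    using IH by blast
  then obtain a where a: "a \<in> carrier G" "b = f a" unfolding Qc by blast
  have "\<exists>i::nat. x \<otimes> inv (a [^] i) \<in> P" if x: "x \<in> carrier G" for x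
  proof -
    have "f x \<in> powers Q b" using b(2) Qc x by blast
    then obtain i :: nat where "f x = f (a [^] i)"
      using a f.hom_nat_pow by (auto simp: powers_def)
    then show ?thesis using f_eq x a by auto
  qed
  then show ?thesis using cyclic_if_cyclic_mod_center[OF a(1)] by blast
qed

end

text \<open>If a stable \<open>y\<close> is central, so are its powers, and \<alpha> maps each of
  them to a power of itself; one of prime order serves as \<open>z\<close> above. Otherwise the
  counting argument leaves only the trivial group.\<close>

lemma cyclic_step:
  assumes subgroups: "\<And>M. subgroup M G \<Longrightarrow> M \<noteq> carrier G \<Longrightarrow> \<alpha> ` M \<subseteq> M \<Longrightarrow> \<exists>c\<in>M. M = powers G c"
    and smaller: "\<And>(Q :: 'a monoid) \<beta>. fpf_group Q \<beta> \<Longrightarrow> card (carrier Q) < card (carrier G) \<Longrightarrow>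
      \<exists>c\<in>carrier Q. carrier Q = powers Q c"
  shows "\<exists>c\<in>carrier G. carrier G = powers G c"
proof (cases "\<exists>y. stable y \<and> centralizer y = carrier G")
  case True
  then obtain y where y: "stable y" "centralizer y = carrier G" by blast
  have yc: "y \<in> carrier G" "y \<noteq> \<one>" using y(1) by (simp_all add: stable_def)
  obtain q m :: nat where q: "Factorial_Ring.prime q" "y [^] m \<noteq> \<one>" "(y [^] m) [^] q = \<one>"
    using exists_prime_order_pow[OF finite_carrier yc] by blast
  obtain k :: nat where "\<alpha> y = y [^] k" using y(1) by (auto simp: stable_def powers_def)
  then have "\<alpha> (y [^] m) = (y [^] m) [^] k"
    using yc by (simp add: aut_pow nat_pow_pow mult.commute)
  then have ym: "\<alpha> (y [^] m) \<in> powers G (y [^] m)"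
    by (simp add: pow_in_powers)
  have central: "x \<otimes> y [^] m = y [^] m \<otimes> x" if "x \<in> carrier G" for x
    using mem_centralizer_powers[OF that yc(1) _ pow_in_powers] that y(2)
    by (auto simp: centralizer_def)
  show ?thesis
    by (rule cyclic_by_central_quotient[OF nat_pow_closed[OF yc(1)] q(2,3,1) ym central smaller])
next
  case False
  have "carrier G = {\<one>}"
    using trivial_if_no_central_stable[OF subgroups] False by blast
  then show ?thesis
    using powers_in_carrier[of \<one>] one_in_powers by auto
qed

end

text \<open>The induction stays within one type: subgroups only change the carrier, and the quotient
  was built on coset representatives.\<close>

theorem fpf_group_cyclic:
  fixes G :: "'a monoid"
  assumes "fpf_group G \<alpha>"
  shows "\<exists>c\<in>carrier G. carrier G = powers G c"
  using assms
proof (induction "card (carrier G)" arbitrary: G \<alpha> rule: less_induct)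
  case less
  interpret fpf_group G \<alpha> by fact
  show ?case
  proof (rule cyclic_step)
    fix M assume M: "subgroup M G" "M \<noteq> carrier G" "\<alpha> ` M \<subseteq> M"
    have "card M < card (carrier G)"
      using subgroup.subset[OF M(1)] M(2) finite_carrier by (intro psubset_card_mono) auto
    then show "\<exists>c\<in>M. M = powers G c"
      using less.hyps[of "G\<lparr>carrier := M\<rparr>" \<alpha>] fpf_subgroup[OF M(1,3)]
      by (simp add: powers_carrier_update)
  qed (use less.hyps in blast)
qed

section \<open>Frobenius groups whose kernel is a p-group\<close>

lemma (in comm_monoid) finprod_swap_lessThan:
  fixes m n :: nat
  assumes "\<And>i j. i < m \<Longrightarrow> j < n \<Longrightarrow> f i j \<in> carrier G"
  shows "finprod G (\<lambda>j. finprod G (\<lambda>i. f i j) {..<m}) {..<n} = finprod G (\<lambda>i. finprod G (f i) {..<n}) {..<m}"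
  using assms
proof (induction n)
  case (Suc n)
  have "finprod G (\<lambda>j. finprod G (\<lambda>i. f i j) {..<m}) {..<Suc n}
      = finprod G (\<lambda>i. f i n) {..<m} \<otimes> finprod G (\<lambda>j. finprod G (\<lambda>i. f i j) {..<m}) {..<n}"
    using Suc.prems by (simp add: lessThan_Suc Pi_def)
  also have "\<dots> = finprod G (\<lambda>i. f i n) {..<m} \<otimes> finprod G (\<lambda>i. finprod G (f i) {..<n}) {..<m}"
    using Suc by simp
  also have "\<dots> = finprod G (\<lambda>i. f i n \<otimes> finprod G (f i) {..<n}) {..<m}"
    using Suc.prems by (intro finprod_multf[symmetric]) (auto simp: Pi_def)
  also have "\<dots> = finprod G (\<lambda>i. finprod G (f i) {..<Suc n}) {..<m}"
    using Suc.prems by (intro finprod_cong') (auto simp: lessThan_Suc Pi_def)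
  finally show ?case .
qed simp

context group
begin

text \<open>If \<open>y\<close> were not a power of \<open>x\<close>, all elements \<open>x\<^sup>j y\<close> would have order \<open>r\<close>. For \<open>w\<close> of order \<open>r\<close>
  in \<open>W\<close>, the product of the conjugates \<open>w\<^sup>i v w\<^sup>-\<^sup>i\<close> is fixed by \<open>w\<close>, hence trivial; multiplying
  over all \<open>w = x\<^sup>j y\<close> and exchanging the products leaves \<open>v\<^sup>r\<close>.\<close>
lemma fixed_point_free_abelian_exponent:
  fixes r :: nat
  assumes fin: "finite (carrier G)"
    and V: "subgroup V G" and V_comm: "\<And>u v. u \<in> V \<Longrightarrow> v \<in> V \<Longrightarrow> u \<otimes> v = v \<otimes> u"
    and W: "subgroup W G" and WV: "\<And>w v. w \<in> W \<Longrightarrow> v \<in> V \<Longrightarrow> w \<otimes> v \<otimes> inv w \<in> V"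
    and free: "\<And>w v. w \<in> W \<Longrightarrow> v \<in> V \<Longrightarrow> w \<noteq> \<one> \<Longrightarrow> w \<otimes> v = v \<otimes> w \<Longrightarrow> v = \<one>"
    and r: "Factorial_Ring.prime r" and x: "x \<in> W" "x \<noteq> \<one>" "x [^] r = \<one>"
    and y: "y \<in> W" "y [^] r = \<one>" "y \<notin> powers G x" and xy: "x \<otimes> y = y \<otimes> x" and v: "v \<in> V"
  shows "v [^] r = \<one>"
proof -
  let ?V = "G\<lparr>carrier := V\<rparr>"
  interpret V: comm_group ?V
    using subgroup_imp_group[OF V] V_comm by (intro group.group_comm_groupI) auto
  have Vc: "u \<in> carrier G" if "u \<in> V" for u using that subgroup.mem_carrier[OF V] by blast
  have Wc: "w \<in> carrier G" if "w \<in> W" for w using that subgroup.mem_carrier[OF W] by blast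
  have Wpow: "w [^] (k::nat) \<in> W" if "w \<in> W" for w k using subgroup_pow_closed[OF W that] .
  let ?c = "\<lambda>w u. w \<otimes> u \<otimes> inv w"
  let ?N = "\<lambda>w n u. finprod ?V (\<lambda>i. ?c (w [^] i) u) {..<n::nat}"
  have N_closed: "?N w n u \<in> V" if "w \<in> W" "u \<in> V" for w u n
    using V.finprod_closed[of "\<lambda>i. ?c (w [^] i) u" "{..<n}"] that WV Wpow by (auto simp: Pi_def)
  \<comment> \<open>\<open>?N w n u\<close> is a norm, the product of the conjugates of
    \<open>u\<close> by the first \<open>n\<close> powers of \<open>w\<close>. In
    \<open>(u \<otimes> w) [^] n\<close> the factors \<open>w\<close> are moved to the right, which
    turns the copies of \<open>u\<close> into these conjugates.\<close>
  have N_pow: "?N w n u \<otimes> w [^] n = (u \<otimes> w) [^] n" if w: "w \<in> W" and u: "u \<in> V" for w n u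
  proof (induction n)
    case (Suc n)
    note wc = Wc[OF w] and uc = Vc[OF u]
    have "?N w (Suc n) u = ?c (w [^] n) u \<otimes> ?N w n u"
      using w u WV Wpow by (simp add: lessThan_Suc Pi_def)
    also have "\<dots> = ?N w n u \<otimes> ?c (w [^] n) u"
      using V_comm N_closed[OF w u] WV[OF Wpow[OF w] u] by simp
    finally have "?N w (Suc n) u \<otimes> w [^] Suc n = (?N w n u \<otimes> w [^] n) \<otimes> (u \<otimes> w)"
      using wc uc Vc[OF N_closed[OF w u]] by (simp add: m_assoc flip: m_assoc[of "inv (w [^] n)"])
    then show ?case
      using Suc by simp
  qed (use u in simp)
  \<comment> \<open>With \<open>w [^] r = \<one>\<close> the norm equals
    \<open>(u \<otimes> w) [^] r\<close>. It commutes with \<open>u \<otimes> w\<close> as a power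
    of it and with \<open>u\<close> because \<open>V\<close> is abelian, hence with
    \<open>w\<close>; freeness makes it trivial.\<close>
  have N_one: "?N w r u = \<one>" if w: "w \<in> W" "w \<noteq> \<one>" "w [^] r = \<one>" and u: "u \<in> V" for w u
  proof -
    note wc = Wc[OF w(1)] and uc = Vc[OF u]
    define t where "t = ?N w r u"
    have tV: "t \<in> V" unfolding t_def using N_closed[OF w(1) u] .
    note tc = Vc[OF tV]
    have t: "t = (u \<otimes> w) [^] r"
      using N_pow[OF w(1) u, of r] w(3) tc by (simp add: t_def)
    have "u \<otimes> (w \<otimes> t) = (u \<otimes> w) \<otimes> t"
      using wc uc tc by (simp add: m_assoc)
    also have "\<dots> = t \<otimes> (u \<otimes> w)"
      unfolding t using group_commutes_pow[of "u \<otimes> w" "u \<otimes> w" r] wc uc by simp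
    also have "\<dots> = (t \<otimes> u) \<otimes> w"
      using wc uc tc by (simp add: m_assoc)
    also have "t \<otimes> u = u \<otimes> t"
      using V_comm[OF tV u] .
    also have "(u \<otimes> t) \<otimes> w = u \<otimes> (t \<otimes> w)"
      using wc uc tc by (simp add: m_assoc)
    finally have "w \<otimes> t = t \<otimes> w"
      using wc uc tc by simp
    then show ?thesis using free[OF w(1) tV w(2)] by (simp add: t_def)
  qed
  note xc = Wc[OF x(1)] and yc = Wc[OF y(1)] and vc = Vc[OF v]
  have xjy: "x [^] j \<otimes> y \<in> W" "x [^] j \<otimes> y \<noteq> \<one>" "(x [^] j \<otimes> y) [^] i = x [^] (i * j) \<otimes> y [^] i" for i j :: nat
  proof -
    show "x [^] j \<otimes> y \<in> W" using subgroup.m_closed[OF W Wpow[OF x(1)] y(1)] .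
    show "x [^] j \<otimes> y \<noteq> \<one>"
    proof
      assume "x [^] j \<otimes> y = \<one>"
      then have "y = inv (x [^] j)"
        using xc yc by (metis inv_equality inv_inv nat_pow_closed)
      then show False
        using y(3) subgroup.m_inv_closed[OF subgroup_powers[OF fin xc] pow_in_powers] by simp
    qed
    have "x [^] j \<otimes> y = y \<otimes> x [^] j"
      using group_commutes_pow[OF xy xc yc] .
    then show "(x [^] j \<otimes> y) [^] i = x [^] (i * j) \<otimes> y [^] i"
      using pow_mult_distrib[of "x [^] j" y i] xc yc by (simp add: nat_pow_pow mult.commute)
  qed
  have xjyr: "(x [^] j \<otimes> y) [^] r = \<one>" for j :: nat
    using xjy(3)[where i = r and j = j] x(3) y(2) xc by (simp flip: nat_pow_pow)
  \<comment> \<open>\<open>?a i j\<close> is the conjugate of \<open>v\<close> by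
    \<open>(x [^] j \<otimes> y) [^] i\<close>, so for fixed \<open>j\<close> the product over
    \<open>i\<close> is a trivial norm.\<close>
  let ?a = "\<lambda>i j. ?c (x [^] (i * j) \<otimes> y [^] i) v"
  have aV: "?a i j \<in> V" for i j :: nat
    using WV[OF subgroup.m_closed[OF W Wpow[OF x(1)] Wpow[OF y(1)]] v] .
  have "finprod ?V (\<lambda>i. ?a i j) {..<r} = \<one>" for j
    using N_one[OF xjy(1,2)[of j] xjyr[of j] v] by (simp add: xjy(3))
  then have "finprod ?V (\<lambda>j. finprod ?V (\<lambda>i. ?a i j) {..<r}) {..<r} = \<one>"
    using V.finprod_one by simp
  then have one: "finprod ?V (\<lambda>i. finprod ?V (?a i) {..<r}) {..<r} = \<one>"
    using V.finprod_swap_lessThan[of r r ?a] aV by simp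
  \<comment> \<open>For \<open>i \<noteq> 0\<close> the product over \<open>j\<close> is the norm,
    under the element \<open>x [^] i\<close> of order \<open>r\<close>, of a conjugate of
    \<open>v\<close>; for \<open>i = 0\<close> all \<open>r\<close> factors are
    \<open>v\<close>.\<close>
  have inner: "finprod ?V (?a i) {..<r} = (if i = 0 then v [^] r else \<one>)" if i: "i < r" for i
  proof (cases "i = 0")
    case True
    then show ?thesis
      using V.finprod_const[of v "{..<r}"] v vc by (simp add: pow_carrier_update)
  next
    case False
    have "\<not> r dvd i" using i False by (auto dest: dvd_imp_le)
    then have "x [^] i \<noteq> \<one>"
      using ord_prime[OF xc x(2,3) r] xc by (simp add: pow_eq_id)
    moreover have "(x [^] i) [^] r = \<one>"
      using powers_pow_prime[OF xc x(3) pow_in_powers] .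
    moreover have "?c (y [^] i) v \<in> V" using WV[OF Wpow[OF y(1)] v] .
    ultimately have "?N (x [^] i) r (?c (y [^] i) v) = \<one>"
      using N_one Wpow[OF x(1)] by blast
    moreover have "?c ((x [^] i) [^] j) (?c (y [^] i) v) = ?a i j" for j
      using xc yc vc by (simp add: conj_conj nat_pow_pow)
    ultimately show ?thesis using False by simp
  qed
  have "finprod ?V (\<lambda>i. finprod ?V (?a i) {..<r}) {..<r}
      = finprod ?V (\<lambda>i. if i = 0 then v [^] r else \<one>) {..<r}"
    using inner subgroup_pow_closed[OF V v] subgroup.one_closed[OF V] by (intro V.finprod_cong') (auto simp: Pi_def)
  also have "\<dots> = v [^] r"
    using V.finprod_singleton[of 0 "{..<r}" "\<lambda>_. v [^] r"] prime_gt_0_nat[OF r] subgroup_pow_closed[OF V v]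
    by (simp add: Pi_def eq_commute cong: if_cong)
  finally show ?thesis using one by simp
qed

end

section \<open>The complement of a p-group kernel: rank, cosets, cyclicity\<close>

locale frobenius_p_kernel = group +
  fixes H K :: "'a set" and p n :: nat
  assumes finite_carrier: "finite (carrier G)"
    and compl: "frobenius_complement G H"
    and kernel: "K = frobenius_kernel G H"
    and K_normal: "K \<lhd> G"
    and p: "Factorial_Ring.prime p"
    and card_K: "card K = p ^ n"
begin

lemma H_subgroup: "subgroup H G"
  using compl by (simp add: frobenius_complement_def)

lemma K_subgroup: "subgroup K G"
  using K_normal by (rule normal_imp_subgroup)

lemma H_carrier: "h \<in> H \<Longrightarrow> h \<in> carrier G"
  using subgroup.mem_carrier[OF H_subgroup] .

lemma K_carrier: "k \<in> K \<Longrightarrow> k \<in> carrier G"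
  using subgroup.mem_carrier[OF K_subgroup] .

lemma Int_eq_one: "h \<in> H \<Longrightarrow> h \<in> K \<Longrightarrow> h = \<one>"
proof -
  assume h: "h \<in> H" "h \<in> K"
  then have "h \<in> \<one> <# (H #> inv \<one>)"
    using mem_conj_set_iff[OF subgroup.subset[OF H_subgroup], of \<one> h] H_carrier by simp
  then show "h = \<one>"
    using h(2) unfolding kernel frobenius_kernel_def by blast
qed

text \<open>A nontrivial \<open>h\<close> commuting with \<open>k\<close> lies in \<open>H\<close>
  and in its conjugate by \<open>k\<close>, which puts \<open>k\<close> in \<open>H\<close> and so
  in the intersection with \<open>K\<close>.\<close>

lemma free: 
  assumes "h \<in> H" "k \<in> K" "h \<noteq> \<one>" "h \<otimes> k = k \<otimes> h"
  shows "k = \<one>"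
proof -
  have c: "h \<in> carrier G" "k \<in> carrier G" using assms H_carrier K_carrier by blast+
  have "inv k \<otimes> h \<otimes> k = h"
    using c assms(4) by (metis inv_closed inv_solve_left m_assoc m_closed)
  then have "h \<in> H \<inter> (k <# (H #> inv k))"
    using mem_conj_set_iff[OF subgroup.subset[OF H_subgroup] c(2)] c assms(1) by simp
  then have "k \<in> H"
    using compl c assms(3) unfolding frobenius_complement_def by blast
  then show ?thesis using Int_eq_one assms(2) by blast
qed

lemma card_K_H: "card K * card H = order G"
  using card_frobenius_kernel(2)[OF finite_carrier compl] kernel by simp

lemma K_nontrivial: "K \<noteq> {\<one>}"
proof
  assume "K = {\<one>}"
  then have "card H = card (carrier G)" using card_K_H by (simp add: order_def)
  then have "H = carrier G"
    using card_subset_eq[OF finite_carrier subgroup.subset[OF H_subgroup]] by simp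
  then show False using compl by (simp add: frobenius_complement_def)
qed

text \<open>A nontrivial \<open>p\<close>-element of \<open>H\<close> would centralize a nontrivial
  element of the \<open>p\<close>-group \<open>K\<close>, against freeness.\<close>

lemma H_no_p_elements:
  assumes "h \<in> H" "h [^] (p ^ m) = \<one>"
  shows "h = \<one>"
proof (rule ccontr)
  assume "h \<noteq> \<one>"
  have "\<exists>k\<in>K. k \<noteq> \<one> \<and> h \<otimes> k = k \<otimes> h"
    using p_group_nontrivial_fixed_point[OF finite_carrier H_carrier[OF assms(1)] assms(2) p K_subgroup card_K K_nontrivial]
      normal.inv_op_closed2[OF K_normal H_carrier[OF assms(1)]] by blast
  then show False using free[OF assms(1)] \<open>h \<noteq> \<one>\<close> by blast
qed

text \<open>\<open>H\<close> acts freely by conjugation on the centre \<open>V\<close> of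
  \<open>K\<close>, a nontrivial abelian \<open>p\<close>-group. If \<open>y\<close> were not a
  power of \<open>x\<close>, all elements of \<open>V\<close> would have trivial \<open>r\<close>-th
  power; but \<open>r \<noteq> p\<close>, because \<open>H\<close> has no elements of order
  \<open>p\<close>.\<close>

lemma rank_le_one_complement: "rank_le_one (G\<lparr>carrier := H\<rparr>)"
  unfolding rank_le_one_def
proof (intro allI impI)
  fix r :: nat and x y
  assume r: "Factorial_Ring.prime r"
    and "x \<in> carrier (G\<lparr>carrier := H\<rparr>)" "y \<in> carrier (G\<lparr>carrier := H\<rparr>)"
    "x \<otimes>\<^bsub>G\<lparr>carrier := H\<rparr>\<^esub> y = y \<otimes>\<^bsub>G\<lparr>carrier := H\<rparr>\<^esub> x"
    "x [^]\<^bsub>G\<lparr>carrier := H\<rparr>\<^esub> r = \<one>\<^bsub>G\<lparr>carrier := H\<rparr>\<^esub>" "y [^]\<^bsub>G\<lparr>carrier := H\<rparr>\<^esub> r = \<one>\<^bsub>G\<lparr>carrier := H\<rparr>\<^esub>"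
    "x \<noteq> \<one>\<^bsub>G\<lparr>carrier := H\<rparr>\<^esub>"
  then have xy: "x \<in> H" "y \<in> H" "x \<otimes> y = y \<otimes> x" "x [^] r = \<one>" "y [^] r = \<one>" "x \<noteq> \<one>"
    by (simp_all add: pow_carrier_update)
  have "r \<noteq> p"
    using H_no_p_elements[OF xy(1), of 1] xy(4,6) by auto
  let ?K = "G\<lparr>carrier := K\<rparr>"
  interpret K: group ?K using K_subgroup by (rule subgroup_imp_group)
  have finK: "finite K" using finite_carrier subgroup.subset[OF K_subgroup] finite_subset by blast
  define V where "V = {v \<in> K. \<forall>k\<in>K. k \<otimes> v = v \<otimes> k}"
  have V_iff: "v \<in> V \<longleftrightarrow> v \<in> K \<and> (\<forall>k\<in>K. v \<in> centralizer k)" for v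
    using K_carrier by (auto simp: V_def centralizer_def)
  have V: "subgroup V G"
  proof (rule subgroup.intro)
    fix a b assume "a \<in> V" "b \<in> V"
    then show "a \<otimes> b \<in> V"
      unfolding V_iff using subgroup.m_closed[OF K_subgroup] subgroup.m_closed[OF subgroup_centralizer] K_carrier
      by blast
  next
    fix a assume "a \<in> V"
    then show "inv a \<in> V"
      unfolding V_iff using subgroup.m_inv_closed[OF K_subgroup] subgroup.m_inv_closed[OF subgroup_centralizer] K_carrier
      by blast
  qed (use K_carrier subgroup.one_closed[OF K_subgroup] in \<open>auto simp: V_def\<close>)
  have "\<exists>z\<in>K. z \<noteq> \<one> \<and> (\<forall>x\<in>K. x \<otimes> z = z \<otimes> x)"
    using K.p_group_center_nontrivial[of p n] finK card_K p K_nontrivial by (simp add: order_def)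
  then obtain z where z: "z \<in> V" "z \<noteq> \<one>" by (auto simp: V_def)
  have conj: "w \<otimes> v \<otimes> inv w \<in> V" if w: "w \<in> H" and v: "v \<in> V" for w v
  proof -
    have c: "w \<in> carrier G" "v \<in> carrier G" using w v H_carrier K_carrier by (auto simp: V_def)
    have "w \<otimes> v \<otimes> inv w \<in> centralizer k" if k: "k \<in> K" for k
    proof -
      have "inv w \<otimes> k \<otimes> w \<in> K"
        using normal.inv_op_closed1[OF K_normal c(1) k] .
      then have "v \<in> centralizer (inv w \<otimes> k \<otimes> w)" using v V_iff by blast
      then show ?thesis
        using conj_mem_centralizer_iff[OF c, of "inv w \<otimes> k \<otimes> w"] c K_carrier[OF k] by simp
    qed
    then show ?thesis
      using normal.inv_op_closed2[OF K_normal c(1)] v V_iff by blast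
  qed
  have V_comm: "u \<otimes> v = v \<otimes> u" if "u \<in> V" "v \<in> V" for u v
    using that unfolding V_def by blast
  have V_free: "v = \<one>" if "w \<in> H" "v \<in> V" "w \<noteq> \<one>" "w \<otimes> v = v \<otimes> w" for w v
    using free[OF that(1) _ that(3,4)] that(2) unfolding V_def by blast
  show "y \<in> powers (G\<lparr>carrier := H\<rparr>) x"
  proof (rule ccontr)
    assume "y \<notin> powers (G\<lparr>carrier := H\<rparr>) x"
    then have y: "y \<notin> powers G x" by (simp add: powers_carrier_update)
    have "z [^] r = \<one>"
      by (rule fixed_point_free_abelian_exponent[OF finite_carrier V V_comm H_subgroup conj V_free r xy(1,6,4) xy(2,5) y xy(3) z(1)])
    then have "ord z = r" using ord_prime[OF _ z(2) _ r] K_carrier z(1) unfolding V_def by blast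
    moreover have "z [^] (p ^ n) = \<one>"
      using K.pow_order_eq_1[of z] z(1) card_K by (simp add: order_def V_def pow_carrier_update)
    ultimately have "r dvd p ^ n"
      using pow_eq_id K_carrier z(1) by (auto simp: V_def)
    then show False
      using \<open>r \<noteq> p\<close> r p prime_dvd_power primes_dvd_imp_eq by blast
  qed
qed

lemma rcos_eq_iff: "a \<in> carrier G \<Longrightarrow> b \<in> carrier G \<Longrightarrow> K #> a = K #> b \<longleftrightarrow> a \<otimes> inv b \<in> K"
  using subgroup.rcos_module[OF K_subgroup is_group] repr_independence[OF _ _ K_subgroup] rcos_self[OF _ K_subgroup]
  by metis

lemma rcos_inj: "a \<in> H \<Longrightarrow> b \<in> H \<Longrightarrow> K #> a = K #> b \<Longrightarrow> a = b"
proof -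
  assume ab: "a \<in> H" "b \<in> H" "K #> a = K #> b"
  then have "a \<otimes> inv b \<in> K" using rcos_eq_iff H_carrier by blast
  moreover have "a \<otimes> inv b \<in> H"
    using subgroup.m_closed[OF H_subgroup ab(1) subgroup.m_inv_closed[OF H_subgroup ab(2)]] .
  ultimately have "a \<otimes> inv b = \<one>" using Int_eq_one by blast
  then show "a = b" using ab H_carrier by (metis inv_equality inv_inv inv_closed)
qed

text \<open>Distinct elements of \<open>H\<close> lie in distinct cosets, and \<open>card H\<close>
  is the index of \<open>K\<close>, so \<open>H\<close> is a full set of coset
  representatives.\<close>

lemma rcos_surj:
  assumes "C \<in> carrier (G Mod K)"
  shows "\<exists>h\<in>H. C = K #> h"
proof -
  have "inj_on ((#>) K) H" using rcos_inj by (auto intro: inj_onI)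
  then have "card ((#>) K ` H) = card H" by (rule card_image)
  moreover have "card (rcosets K) * card K = card H * card K"
    using lagrange[OF K_subgroup] card_K_H by (simp add: mult.commute)
  moreover have "card K > 0" using card_K p prime_gt_0_nat by simp
  ultimately have "card ((#>) K ` H) = card (rcosets K)" by simp
  moreover have "(#>) K ` H \<subseteq> rcosets K" using H_carrier by (auto simp: RCOSETS_def)
  moreover have "finite (rcosets K)" using finite_carrier by (simp add: RCOSETS_def)
  ultimately have "(#>) K ` H = rcosets K" by (intro card_subset_eq)
  then show ?thesis using assms by (auto simp: FactGroup_def)
qed

text \<open>The rank condition is carried from \<open>H\<close> to the isomorphic quotient by
  \<open>K\<close> because the fixed-point-free automorphism will be found there;
  \<open>complement_cyclic\<close> carries the resulting cyclicity back.\<close>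

lemma rank_le_one_quotient: "rank_le_one (G Mod K)"
  unfolding rank_le_one_def
proof (intro allI impI)
  fix r :: nat and C D
  assume r: "Factorial_Ring.prime r"
    and CD: "C \<in> carrier (G Mod K)" "D \<in> carrier (G Mod K)"
    "C \<otimes>\<^bsub>G Mod K\<^esub> D = D \<otimes>\<^bsub>G Mod K\<^esub> C"
    "C [^]\<^bsub>G Mod K\<^esub> r = \<one>\<^bsub>G Mod K\<^esub>" "D [^]\<^bsub>G Mod K\<^esub> r = \<one>\<^bsub>G Mod K\<^esub>" "C \<noteq> \<one>\<^bsub>G Mod K\<^esub>"
  obtain x y where xy: "x \<in> H" "C = K #> x" "y \<in> H" "D = K #> y"
    using rcos_surj CD(1,2) by blast
  note c = H_carrier[OF xy(1)] H_carrier[OF xy(3)]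
  have K1: "K #> \<one> = K" using subgroup.subset[OF K_subgroup] by simp
  have trivial: "h = \<one>" if "h \<in> H" "K #> h = K" for h
    using rcos_inj[OF that(1) subgroup.one_closed[OF H_subgroup]] that(2) K1 by simp
  note inH = subgroup.m_closed[OF H_subgroup] subgroup_pow_closed[OF H_subgroup] subgroup.one_closed[OF H_subgroup]
  have pow: "(K #> a) [^]\<^bsub>G Mod K\<^esub> (k::nat) = K #> a [^] k" if "a \<in> carrier G" for a k
    using normal.FactGroup_pow[OF K_normal that] by simp
  have "K #> x \<otimes> y = K #> y \<otimes> x"
    using CD(3) xy c by (simp add: normal.rcos_sum[OF K_normal])
  then have "x \<otimes> y = y \<otimes> x" using rcos_inj inH xy by blast
  moreover have "x [^] r = \<one>"
    by (rule trivial[OF inH(2)[OF xy(1)]]) (use CD(4) xy(2) pow[OF c(1)] in simp)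
  moreover have "y [^] r = \<one>"
    by (rule trivial[OF inH(2)[OF xy(3)]]) (use CD(5) xy(4) pow[OF c(2)] in simp)
  moreover have "x \<noteq> \<one>" using CD(6) xy K1 by auto
  ultimately have "y \<in> powers (G\<lparr>carrier := H\<rparr>) x"
    using rank_le_oneD[OF rank_le_one_complement r] xy by (simp add: pow_carrier_update)
  then have "y \<in> powers G x" by (simp only: powers_carrier_update)
  then obtain i :: nat where "y = x [^] i" by (auto simp: powers_def)
  then have "D = C [^]\<^bsub>G Mod K\<^esub> i" using xy pow c by simp
  then show "D \<in> powers (G Mod K) C" by (auto simp: powers_def)
qed

lemma complement_cyclic:
  assumes "C \<in> carrier (G Mod K)" "carrier (G Mod K) = powers (G Mod K) C"
  shows "\<exists>h\<in>H. H = powers G h"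
proof -
  obtain h where h: "h \<in> H" "C = K #> h" using rcos_surj assms(1) by blast
  have "x \<in> powers G h" if x: "x \<in> H" for x
  proof -
    have "K #> x \<in> carrier (G Mod K)" using H_carrier[OF x] by (auto simp: carrier_FactGroup)
    then obtain i :: nat where "K #> x = C [^]\<^bsub>G Mod K\<^esub> i"
      using assms(2) by (auto simp: powers_def)
    then have "K #> x = K #> h [^] i"
      using normal.FactGroup_pow[OF K_normal H_carrier[OF h(1)]] h(2) by simp
    then have "x = h [^] i" using rcos_inj x subgroup_pow_closed[OF H_subgroup h(1)] by blast
    then show ?thesis by (simp add: pow_in_powers)
  qed
  then show ?thesis using h powers_subset_subgroup[OF H_subgroup] by blast
qed

end

section \<open>The action of a complement on a normal kernel\<close>

context group
begin

text \<open>Conjugation by a nontrivial \<open>t\<close> in \<open>T\<close> serves as \<alpha>. If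
  it fixes \<open>x\<close>, then \<open>t\<close> lies in \<open>T\<close> and in its conjugate by
  \<open>x\<close>, so \<open>x\<close> lies in \<open>T\<close>, which meets the kernel only in the
  identity.\<close>

lemma frobenius_kernel_fpf:
  assumes fin: "finite (carrier G)" and T: "frobenius_complement G T"
    and N: "N = frobenius_kernel G T" "N \<lhd> G" and rank: "rank_le_one (G\<lparr>carrier := N\<rparr>)"
  shows "\<exists>\<alpha>. fpf_group (G\<lparr>carrier := N\<rparr>) \<alpha>"
proof -
  have Tsub: "subgroup T G" "T \<noteq> {\<one>}" using T by (simp_all add: frobenius_complement_def)
  have Nsub: "subgroup N G" using N(2) by (rule normal_imp_subgroup)
  have Nc: "x \<in> carrier G" if "x \<in> N" for x using that subgroup.mem_carrier[OF Nsub] by blast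
  obtain t where t: "t \<in> T" "t \<noteq> \<one>" using Tsub subgroup.one_closed by blast
  have tc: "t \<in> carrier G" using subgroup.mem_carrier[OF Tsub(1) t(1)] .
  let ?\<alpha> = "\<lambda>x. t \<otimes> x \<otimes> inv t"
  interpret N: group "G\<lparr>carrier := N\<rparr>" using Nsub by (rule subgroup_imp_group)
  have closed: "?\<alpha> x \<in> N" "inv t \<otimes> x \<otimes> t \<in> N" if "x \<in> N" for x
    using normal.inv_op_closed2[OF N(2) tc that] normal.inv_op_closed1[OF N(2) tc that] .
  have "fpf_group (G\<lparr>carrier := N\<rparr>) ?\<alpha>"
  proof unfold_locales
    show "finite (carrier (G\<lparr>carrier := N\<rparr>))" using fin subgroup.subset[OF Nsub] finite_subset by auto
    have "bij_betw ?\<alpha> N N"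
      by (rule bij_betw_byWitness[where f' = "\<lambda>x. inv t \<otimes> x \<otimes> t"]) (use closed tc Nc in auto)
    then show "?\<alpha> \<in> iso (G\<lparr>carrier := N\<rparr>) (G\<lparr>carrier := N\<rparr>)"
      using closed(1) tc Nc by (auto simp: iso_def hom_def conj_mult)
    show "rank_le_one (G\<lparr>carrier := N\<rparr>)" by fact
  next
    fix x assume "x \<in> carrier (G\<lparr>carrier := N\<rparr>)" and eq: "?\<alpha> x = x"
    then have x: "x \<in> N" "x \<in> carrier G" using Nc by simp_all
    have "t \<otimes> x = x \<otimes> t" using conj_eq_iff_commute[OF tc x(2)] eq by simp
    then have "inv x \<otimes> t \<otimes> x = t"
      using tc x(2) by (metis inv_closed inv_solve_left m_assoc m_closed)
    then have "t \<in> T \<inter> (x <# (T #> inv x))"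
      using mem_conj_set_iff[OF subgroup.subset[OF Tsub(1)] x(2)] tc t(1) by simp
    then have "x \<in> T"
      using T x(2) t(2) unfolding frobenius_complement_def by blast
    then have "x \<in> \<one> <# (T #> inv \<one>)"
      using mem_conj_set_iff[OF subgroup.subset[OF Tsub(1)], of \<one> x] x by simp
    then have "x = \<one>"
      using x(1) unfolding N(1) frobenius_kernel_def by blast
    then show "x = \<one>\<^bsub>G\<lparr>carrier := N\<rparr>\<^esub>"
      by simp
  qed
  then show ?thesis by blast
qed

text \<open>Outside the kernel \<open>x\<close> lies in a conjugate of \<open>T\<close> together
  with its powers, and conjugates of \<open>T\<close> meet the kernel trivially. This will show that
  elements outside \<open>L\<close> have \<open>p\<close>-power order.\<close>

lemma frobenius_complement_pow_in_kernel:
  fixes m :: nat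
  assumes T: "frobenius_complement G T" and N: "N = frobenius_kernel G T" "N \<lhd> G"
    and x: "x \<in> carrier G" "x \<notin> N" "x [^] m \<in> N"
  shows "x [^] m = \<one>"
proof -
  have Tsub: "subgroup T G" using T by (simp add: frobenius_complement_def)
  obtain g where g: "g \<in> carrier G" "x \<in> g <# (T #> inv g)"
    using x(1,2) unfolding N(1) frobenius_kernel_def by blast
  note iff = mem_conj_set_iff[OF subgroup.subset[OF Tsub] g(1)]
  have "inv g \<otimes> x \<otimes> g \<in> T" using g(2) iff by blast
  then have "(inv g \<otimes> x \<otimes> g) [^] m \<in> T" using subgroup_pow_closed[OF Tsub] by blast
  then have "inv g \<otimes> x [^] m \<otimes> g \<in> T"
    using conj_pow[of "inv g" x m] g(1) x(1) by simp
  then have "x [^] m \<in> g <# (T #> inv g)" using iff x(1) by simp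
  then show ?thesis
    using x(3) g(1) unfolding N(1) frobenius_kernel_def by blast
qed

end

section \<open>Connected components of the cyclic graph\<close>

lemma (in wf_digraph) strongly_connected_imp_connected:
  assumes "strongly_connected G"
  shows "connected G"
  unfolding connected_def
  using assms reachable_mk_symmetricI by (auto simp: strongly_connected_def)

lemma subgraph_antisym: "subgraph C D \<Longrightarrow> subgraph D C \<Longrightarrow> C = D"
  by (auto simp: subgraph_def compatible_def intro!: pre_digraph.equality)

text \<open>A maximal connected subgraph is induced, hence symmetric, and for symmetric digraphs
  connectedness is strong connectedness. The components thus become the strongly connected ones,
  which reachability determines.\<close>

lemma (in wf_digraph) max_subgraph_connected_iff:
  assumes "symmetric G"
  shows "max_subgraph connected C \<longleftrightarrow> C \<in> sccs"
proof
  have sc: "connected H" if "subgraph H G" "strongly_connected H" for H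
    using that wf_digraph.strongly_connected_imp_connected[of H] by blast
  have "connected H2" if "connected H1" "subgraph H1 H2" "verts H1 = verts H2" for H1 H2 :: "('a, 'b) pre_digraph"
    using that wf_digraph.connected_spanning_imp_connected[of H2 H1] by (auto simp: spanning_def)
  then have mono: "arc_mono (connected :: ('a, 'b) pre_digraph \<Rightarrow> bool)"
    unfolding arc_mono_def by blast
  assume C: "max_subgraph connected C"
  then have ind: "induced_subgraph C G"
    using induced_subgraphI_arc_mono mono by blast
  then have "symmetric C"
    using assms induced_graph_imp_symmetric by blast
  then have "strongly_connected C"
    using C wf_digraph.symmetric_connected_imp_strongly_connected[of C] max_subgraph_prop[OF C]
      subgraphI_max_subgraph[OF C] by blast
  then show "C \<in> sccs"
    using C sc unfolding sccs_altdef2 max_subgraph_def by blast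
next
  assume "C \<in> sccs"
  then have C: "max_subgraph strongly_connected C" by (simp add: sccs_altdef2)
  show "max_subgraph connected C"
  proof (rule max_subgraphI)
    show "connected C"
      using wf_digraph.strongly_connected_imp_connected[of C] max_subgraph_prop[OF C]
        subgraphI_max_subgraph[OF C] by blast
    show "subgraph C G" using subgraphI_max_subgraph[OF C] .
  next
    fix D assume D: "C \<noteq> D" "subgraph C D" "subgraph D G"
    show "\<not> connected D"
    proof
      assume "connected D"
      \<comment> \<open>\<open>D\<close> may lack reversed arcs; the subgraph induced on its
        vertices is symmetric, so it is strongly connected and the maximality of \<open>C\<close>
        applies to it.\<close>
      let ?D = "G \<restriction> verts D"
      have vs: "verts D \<subseteq> verts G" using D(3) by (simp add: subgraph_def)
      have sub: "subgraph D ?D" "subgraph ?D G"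
        using subgraph_induce_subgraphI2[OF D(3)] induced_imp_subgraph[OF induced_induce[OF vs]] .
      interpret D: wf_digraph ?D by (rule wellformed_induce_subgraph)
      have "connected ?D"
        using D.connected_spanning_imp_connected[of D] sub(1) \<open>connected D\<close> by (simp add: spanning_def)
      moreover have "symmetric ?D"
        using induced_graph_imp_symmetric[OF assms induced_induce[OF vs]] .
      ultimately have "strongly_connected ?D"
        using D.symmetric_connected_imp_strongly_connected by blast
      then have "C = ?D"
        using C sub(2) subgraph_trans[OF D(2) sub(1)] unfolding max_subgraph_def by metis
      then have "subgraph D C" using sub(1) by simp
      then have "C = D" using D(2) subgraph_antisym by blast
      then show False using D(1) by simp
    qed
  qed
qed

text \<open>\<open>f\<close> is a complete invariant of reachability, so its fibres are the vertex
  sets of the components.\<close>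

lemma card_connected_components:
  fixes D :: "'a pair_pre_digraph"
  assumes "pair_graph D"
    and arc: "\<And>u v. (u, v) \<in> parcs D \<Longrightarrow> f u = f v"
    and reach: "\<And>u v. u \<in> pverts D \<Longrightarrow> v \<in> pverts D \<Longrightarrow> f u = f v \<Longrightarrow> u \<rightarrow>\<^sup>*\<^bsub>with_proj D\<^esub> v"
  shows "card (connected_components D) = card (f ` pverts D)"
proof -
  interpret pair_graph D by fact
  have "connected_components (with_proj D) = sccs"
    using max_subgraph_connected_iff pair_sym_arcs by (auto simp: connected_components_def)
  then have 1: "card (connected_components D) = card sccs_verts"
    by (simp add: card_sccs_verts)
  have f_reach: "f u = f v" if "u \<rightarrow>\<^sup>*\<^bsub>with_proj D\<^esub> v" for u v
    using that by (induction rule: reachable_induct) (use arc in auto)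
  have reach_iff: "u \<rightarrow>\<^sup>*\<^bsub>with_proj D\<^esub> v \<longleftrightarrow> u \<in> pverts D \<and> v \<in> pverts D \<and> f u = f v" for u v
    using f_reach reach reachable_in_verts by blast
  let ?class = "\<lambda>c. {v \<in> pverts D. f v = c}"
  have "sccs_verts = ?class ` f ` pverts D"
  proof (intro equalityI subsetI)
    fix S assume S: "S \<in> sccs_verts"
    then obtain u where u: "u \<in> S" unfolding sccs_verts_def by blast
    have reach_S: "\<forall>u\<in>S. \<forall>v\<in>S. u \<rightarrow>\<^sup>*\<^bsub>with_proj D\<^esub> v"
      and max_S: "\<And>u v. u \<in> S \<Longrightarrow> u \<rightarrow>\<^sup>*\<^bsub>with_proj D\<^esub> v \<Longrightarrow> v \<rightarrow>\<^sup>*\<^bsub>with_proj D\<^esub> u \<Longrightarrow> v \<in> S"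
      using S unfolding sccs_verts_def by blast+
    have uv: "u \<in> pverts D" using bspec[OF bspec[OF reach_S u] u] reach_iff by blast
    have "v \<in> pverts D \<and> f v = f u" if "v \<in> S" for v
      using bspec[OF bspec[OF reach_S u] that] reach_iff[of u v] by metis
    moreover have "v \<in> S" if "v \<in> pverts D" "f v = f u" for v
      using max_S[OF u] reach_iff[of u v] reach_iff[of v u] uv that by metis
    ultimately have "S = ?class (f u)" by (intro equalityI subsetI CollectI) (blast, metis (mono_tags) mem_Collect_eq)
    then show "S \<in> ?class ` f ` pverts D" using uv by blast
  next
    fix S assume "S \<in> ?class ` f ` pverts D"
    then obtain u where u: "u \<in> pverts D" "S = ?class (f u)" by blast
    show "S \<in> sccs_verts"
      unfolding sccs_verts_def reach_iff u(2) using u(1) by auto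
  qed
  moreover have "inj_on ?class (f ` pverts D)"
    by (rule inj_onI) blast
  ultimately show ?thesis
    using 1 by (simp add: card_image)
qed

section \<open>Arcs and components of the cyclic graph\<close>

context group
begin

lemma cyclic_graph_arcI:
  assumes "finite (carrier G)" "x \<in> carrier G" "x \<noteq> \<one>" "y \<in> powers G x" "y \<noteq> \<one>" "x \<noteq> y"
  shows "(x, y) \<in> parcs (cyclic_graph G)"
proof -
  have yc: "y \<in> carrier G" using assms powers_in_carrier by blast
  have sub: "subgroup (generate G {x}) G" using generate_is_subgroup assms(2) by simp
  have "x \<in> generate G {x}" by (simp add: generate.incl)
  moreover have "y \<in> generate G {x}" using generate_eq_powers assms by simp
  ultimately have "generate G {x, y} = generate G {x}"
    using generate_subgroup_incl[OF _ sub, of "{x, y}"] mono_generate[of "{x}" "{x, y}"] by blast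
  then have "subgroup_generated G {x, y} = subgroup_generated G {x}"
    using assms(2) yc by (simp add: subgroup_generated_def)
  then show ?thesis
    using assms yc cyclic_group_generated[of x] by (simp add: cyclic_graph_def)
qed

lemma cyclic_graph_arcD:
  assumes "finite (carrier G)" "(x, y) \<in> parcs (cyclic_graph G)"
  shows "\<exists>z\<in>carrier G. x \<in> powers G z \<and> y \<in> powers G z"
proof -
  have xy: "x \<in> carrier G" "y \<in> carrier G" and cyc: "cyclic_group (subgroup_generated G {x, y})"
    using assms(2) by (auto simp: cyclic_graph_def)
  let ?S = "subgroup_generated G {x, y}"
  interpret S: group ?S by simp
  obtain z where z: "z \<in> carrier ?S" "carrier ?S = range (\<lambda>n::int. z [^]\<^bsub>?S\<^esub> n)"
    using cyc unfolding S.cyclic_group by blast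
  have zc: "z \<in> carrier G" using z(1) carrier_subgroup_generated_subset by blast
  have "carrier ?S = powers G z"
    using z int_pow_subgroup_generated[OF z(1)] generate_pow[OF zc] generate_eq_powers[OF assms(1) zc] by auto
  moreover have "x \<in> carrier ?S" "y \<in> carrier ?S"
    using xy subgroup_generated_subset_carrier_subset[of "{x, y}"] by auto
  ultimately show ?thesis using zc by blast
qed

text \<open>A nontrivial cyclic \<open>p\<close>-group has a unique subgroup of order
  \<open>p\<close>. If \<open>ord x = p ^ j * p\<close>, it is generated by
  \<open>w = x [^] (p ^ j)\<close>, as \<open>x [^] i\<close> has trivial \<open>p\<close>-th power
  only if \<open>p ^ j\<close> divides \<open>i\<close>.\<close>

lemma p_element_socle:
  fixes p :: nat
  assumes fin: "finite (carrier G)" and x: "x \<in> carrier G" "x \<noteq> \<one>" "x [^] (p ^ n) = \<one>"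
    and p: "Factorial_Ring.prime p"
  shows "\<exists>w\<in>powers G x. ord w = p \<and> {v \<in> powers G x. v [^] p = \<one>} = powers G w"
proof -
  have "ord x dvd p ^ n" using x by (simp add: pow_eq_id)
  then obtain k where k: "ord x = p ^ k" using p divides_primepow_nat by blast
  have "k \<noteq> 0" using k ord_eq_1 x by (metis power_0)
  then obtain j where "k = Suc j" using not0_implies_Suc by blast
  then have j: "ord x = p ^ j * p" using k by simp
  have p0: "p > 0" using p prime_gt_0_nat by simp
  define w where "w = x [^] (p ^ j)"
  have wc: "w \<in> carrier G" using x by (simp add: w_def)
  have "ord w = p"
    using ord_pow[of x "p ^ j"] x j p0 by (simp add: w_def)
  moreover have "{v \<in> powers G x. v [^] p = \<one>} = powers G w"
  proof (intro equalityI subsetI)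
    fix v assume "v \<in> {v \<in> powers G x. v [^] p = \<one>}"
    then obtain i :: nat where i: "v = x [^] i" "v [^] p = \<one>" by (auto simp: powers_def)
    then have "p ^ j * p dvd i * p"
      using x j by (simp add: nat_pow_pow pow_eq_id)
    then have "p ^ j dvd i" using p0 by simp
    then obtain m where "i = p ^ j * m" by (elim dvdE)
    then have "v = w [^] m" using x i by (simp add: w_def nat_pow_pow)
    then show "v \<in> powers G w" by (simp add: pow_in_powers)
  next
    fix v assume v: "v \<in> powers G w"
    then have "v \<in> powers G x" using powers_trans[OF x(1) pow_in_powers] by (simp add: w_def)
    moreover have "v [^] p = \<one>"
      using powers_pow_prime[OF wc _ v] \<open>ord w = p\<close> pow_ord_eq_1[OF wc] by simp
    ultimately show "v \<in> {v \<in> powers G x. v [^] p = \<one>}" by simp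
  qed
  moreover have "w \<in> powers G x" by (simp add: w_def pow_in_powers)
  ultimately show ?thesis by blast
qed

lemma card_powers:
  assumes "finite (carrier G)" "w \<in> carrier G"
  shows "card (powers G w) = ord w"
  using generate_pow_card[OF assms(2)] generate_eq_powers[OF assms] by simp

text \<open>\<open>\<A>\<close> will consist of the conjugates of \<open>H\<close>. A nontrivial
  \<open>p\<close>-element is labelled by its subgroup of order \<open>p\<close>, any other element
  by the member of \<open>\<A>\<close> containing it. Labels do not change on passing to nontrivial
  powers, and arcs join powers of a common element. Conversely, a generator of a label is equal or
  adjacent to every element that carries this label.\<close>

lemma card_components_cyclic_partition:
  fixes p :: nat
  assumes fin: "finite (carrier G)" and p: "Factorial_Ring.prime p"
    and sub: "\<And>A. A \<in> \<A> \<Longrightarrow> subgroup A G" "\<And>A. A \<in> \<A> \<Longrightarrow> A \<noteq> {\<one>}"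
    and cyclic: "\<And>A. A \<in> \<A> \<Longrightarrow> \<exists>h\<in>A. A = powers G h"
    and disj: "\<And>A B x. A \<in> \<A> \<Longrightarrow> B \<in> \<A> \<Longrightarrow> x \<in> A \<Longrightarrow> x \<in> B \<Longrightarrow> x \<noteq> \<one> \<Longrightarrow> A = B"
    and no_p: "\<And>A x n. A \<in> \<A> \<Longrightarrow> x \<in> A \<Longrightarrow> x [^] (p ^ n) = \<one> \<Longrightarrow> x = \<one>"
    and cover: "\<And>x. x \<in> carrier G \<Longrightarrow> (\<exists>n. x [^] (p ^ n) = \<one>) \<or> (\<exists>A\<in>\<A>. x \<in> A)"
  shows "card (connected_components (cyclic_graph G)) = card \<A> + num_subgroups_of_order p G"
proof -
  define pel where "pel x \<longleftrightarrow> (\<exists>n. x [^] (p ^ n) = \<one>)" for x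
  define soc where "soc x = {v \<in> powers G x. v [^] p = \<one>}" for x
  \<comment> \<open>The description operator is applied only to elements that are not
    \<open>p\<close>-elements; such a group element is nontrivial, so by \<open>cover\<close> and
    \<open>disj\<close> exactly one member of \<open>\<A>\<close> contains it.\<close>
  define f where "f x = (if pel x then soc x else (THE A. A \<in> \<A> \<and> x \<in> A))" for x
  have not_pel: "\<not> pel x" if "A \<in> \<A>" "x \<in> A" "x \<noteq> \<one>" for A x
    using no_p[OF that(1,2)] that(3) by (auto simp: pel_def)
  have f_A: "f x = A" if "A \<in> \<A>" "x \<in> A" "x \<noteq> \<one>" for A x
    using not_pel[OF that] disj that unfolding f_def by (auto intro!: the_equality)
  have f_pel: "f x = soc x" if "pel x" for x
    using that by (simp add: f_def)
  have soc: "\<exists>w\<in>powers G x. w \<in> carrier G \<and> ord w = p \<and> soc x = powers G w \<and> card (soc x) = p"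
    if x: "x \<in> carrier G" "x \<noteq> \<one>" "pel x" for x
  proof -
    obtain w where w: "w \<in> powers G x" "ord w = p" "soc x = powers G w"
      using p_element_socle[OF fin x(1,2) _ p] x(3) unfolding pel_def soc_def by blast
    have "w \<in> carrier G" using w(1) powers_in_carrier x(1) by blast
    then show ?thesis using w card_powers[OF fin] by auto
  qed
  have pel_powers: "pel y" if "x \<in> carrier G" "pel x" "y \<in> powers G x" for x y
    using that powers_pow_prime[OF that(1) _ that(3)] by (auto simp: pel_def)
  have f_powers: "f y = f x" if xy: "x \<in> carrier G" "y \<in> powers G x" "y \<noteq> \<one>" for x y
  proof (cases "pel x")
    case True
    have yc: "y \<in> carrier G" using xy powers_in_carrier by blast
    have x1: "x \<noteq> \<one>" using xy by (auto simp: powers_def)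
    have py: "pel y" using pel_powers True xy by blast
    \<comment> \<open>Both sets have \<open>p\<close> elements, so this inclusion is an
      equality.\<close>
    have "soc y \<subseteq> soc x" using powers_trans[OF xy(1,2)] by (auto simp: soc_def)
    moreover have "card (soc x) = card (soc y)" using soc x1 xy yc py True by metis
    moreover have "finite (soc x)"
      using finite_subset[OF powers_in_carrier[OF xy(1)] fin] by (simp add: soc_def)
    ultimately have "soc y = soc x" by (intro card_subset_eq) simp_all
    then show ?thesis using True py by (simp add: f_def)
  next
    case False
    then obtain A where A: "A \<in> \<A>" "x \<in> A" using cover[OF xy(1)] by (auto simp: pel_def)
    have "y \<in> A" using powers_subset_subgroup[OF sub(1)[OF A(1)] A(2)] xy(2) by blast
    moreover have "x \<noteq> \<one>" using xy by (auto simp: powers_def)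
    ultimately show ?thesis using f_A A xy(3) by metis
  qed
  interpret D: pair_graph "cyclic_graph G" using pair_graph_cyclic_graph[OF fin] .
  have verts: "pverts (cyclic_graph G) = carrier G - {\<one>}" by (simp add: cyclic_graph_def)
  have sym: "(y, x) \<in> parcs (cyclic_graph G)" if "(x, y) \<in> parcs (cyclic_graph G)" for x y
    using that by (auto simp: cyclic_graph_def insert_commute)
  have down: "x \<rightarrow>\<^sup>*\<^bsub>with_proj (cyclic_graph G)\<^esub> y" "y \<rightarrow>\<^sup>*\<^bsub>with_proj (cyclic_graph G)\<^esub> x"
    if xy: "x \<in> carrier G" "x \<noteq> \<one>" "y \<in> powers G x" "y \<noteq> \<one>" for x y
  proof -
    have "x \<rightarrow>\<^sup>*\<^bsub>with_proj (cyclic_graph G)\<^esub> y \<and> y \<rightarrow>\<^sup>*\<^bsub>with_proj (cyclic_graph G)\<^esub> x"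
    proof (cases "x = y")
      case True
      then show ?thesis using xy verts by simp
    next
      case False
      then have "(x, y) \<in> parcs (cyclic_graph G)" using cyclic_graph_arcI[OF fin] xy by blast
      then show ?thesis using sym D.reachable_adjI[of x y] D.reachable_adjI[of y x] by simp
    qed
    then show "x \<rightarrow>\<^sup>*\<^bsub>with_proj (cyclic_graph G)\<^esub> y" "y \<rightarrow>\<^sup>*\<^bsub>with_proj (cyclic_graph G)\<^esub> x" by simp_all
  qed
  have "card (connected_components (cyclic_graph G)) = card (f ` pverts (cyclic_graph G))"
  proof (rule card_connected_components[OF D.pair_graph_axioms])
    fix x y assume xy: "(x, y) \<in> parcs (cyclic_graph G)"
    then obtain z where "z \<in> carrier G" "x \<in> powers G z" "y \<in> powers G z"
      using cyclic_graph_arcD[OF fin] by blast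
    moreover have "x \<noteq> \<one>" "y \<noteq> \<one>" using xy by (auto simp: cyclic_graph_def)
    ultimately show "f x = f y" using f_powers by metis
  next
    fix x y assume "x \<in> pverts (cyclic_graph G)" "y \<in> pverts (cyclic_graph G)" and eq: "f x = f y"
    then have x: "x \<in> carrier G" "x \<noteq> \<one>" and y: "y \<in> carrier G" "y \<noteq> \<one>" by (simp_all add: verts)
    \<comment> \<open>A common label would be a member of \<open>\<A>\<close> containing
      \<open>v\<close> and also the subgroup of order \<open>p\<close> below \<open>u\<close>, which
      would make \<open>v\<close> a \<open>p\<close>-element.\<close>
    have mixed: "f u \<noteq> f v" if u: "u \<in> carrier G" "u \<noteq> \<one>" "pel u" and v: "v \<in> carrier G" "v \<noteq> \<one>" "\<not> pel v" for u v
    proof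
      assume eq: "f u = f v"
      obtain A where A: "A \<in> \<A>" "v \<in> A" using cover[OF v(1)] v(3) by (auto simp: pel_def)
      then have "v \<in> soc u" using eq f_A[OF A v(2)] f_pel[OF u(3)] by simp
      then have "v \<in> powers G u" by (simp add: soc_def)
      then show False using pel_powers[OF u(1,3)] v(3) by blast
    qed
    show "x \<rightarrow>\<^sup>*\<^bsub>with_proj (cyclic_graph G)\<^esub> y"
    proof (cases "pel x")
      case True
      then have py: "pel y" using mixed x y eq by blast
      obtain w where w: "w \<in> carrier G" "ord w = p" "soc x = powers G w"
        using soc[OF x True] by blast
      have "w \<noteq> \<one>" using w(2) p by auto
      have "w \<in> soc x" using w self_in_powers by simp
      then have "w \<in> powers G x" "w \<in> powers G y"
        using eq f_pel True py by (auto simp: soc_def)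
      then show ?thesis
        using down(1)[OF x _ \<open>w \<noteq> \<one>\<close>] down(2)[OF y _ \<open>w \<noteq> \<one>\<close>] D.reachable_trans by blast
    next
      case False
      then have ny: "\<not> pel y" using mixed x y eq by metis
      obtain A where A: "A \<in> \<A>" "x \<in> A" using cover[OF x(1)] False by (auto simp: pel_def)
      obtain B where B: "B \<in> \<A>" "y \<in> B" using cover[OF y(1)] ny by (auto simp: pel_def)
      have "A = B" using f_A[OF A x(2)] f_A[OF B y(2)] eq by simp
      obtain h where h: "h \<in> A" "A = powers G h" using cyclic[OF A(1)] by blast
      have hc: "h \<in> carrier G" using h(1) sub(1)[OF A(1)] subgroup.mem_carrier by fast
      have "h \<noteq> \<one>" using h A(2) x(2) by (auto simp: powers_def)
      then show ?thesis
        using down(2)[OF hc _ _ x(2)] down(1)[OF hc _ _ y(2)] h A B \<open>A = B\<close> D.reachable_trans by blast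
    qed
  qed
  also have "f ` pverts (cyclic_graph G) = \<A> \<union> {P. subgroup P G \<and> card P = p}"
  proof (intro equalityI subsetI)
    fix P assume "P \<in> f ` pverts (cyclic_graph G)"
    then obtain x where x: "x \<in> carrier G" "x \<noteq> \<one>" "P = f x" by (auto simp: verts)
    show "P \<in> \<A> \<union> {P. subgroup P G \<and> card P = p}"
    proof (cases "pel x")
      case True
      then show ?thesis
        using soc[OF x(1,2)] f_pel x(3) subgroup_powers[OF fin] by auto
    next
      case False
      then show ?thesis using cover[OF x(1)] f_A x by (auto simp: pel_def)
    qed
  next
    fix P assume "P \<in> \<A> \<union> {P. subgroup P G \<and> card P = p}"
    then show "P \<in> f ` pverts (cyclic_graph G)"
    proof
      assume P: "P \<in> \<A>"
      then obtain x where x: "x \<in> P" "x \<noteq> \<one>"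
        using sub[OF P] subgroup.one_closed[OF sub(1)[OF P]] by blast
      moreover have "x \<in> carrier G" using x(1) subgroup.mem_carrier[OF sub(1)[OF P]] by blast
      ultimately show ?thesis using f_A[OF P x] by (auto simp: verts)
    next
      assume "P \<in> {P. subgroup P G \<and> card P = p}"
      then have P: "subgroup P G" "card P = p" by simp_all
      have "P \<noteq> {\<one>}" using P(2) p by auto
      then obtain w where w: "w \<in> P" "w \<noteq> \<one>" using subgroup.one_closed[OF P(1)] by blast
      have wc: "w \<in> carrier G" using subgroup.mem_carrier[OF P(1) w(1)] .
      interpret P: group "G\<lparr>carrier := P\<rparr>" using P(1) by (rule subgroup_imp_group)
      have wp: "w [^] p = \<one>"
        using P.pow_order_eq_1[of w] w(1) P(2) by (simp add: order_def pow_carrier_update)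
      have finP: "finite P" using subgroup.subset[OF P(1)] fin finite_subset by blast
      have "powers G w \<subseteq> P" using powers_subset_subgroup[OF P(1) w(1)] .
      moreover have "card (powers G w) = card P"
        using card_powers[OF fin wc] ord_prime[OF wc w(2) wp p] P(2) by simp
      ultimately have "powers G w = P" using finP by (intro card_subset_eq)
      moreover have "soc w = powers G w"
        using powers_pow_prime[OF wc wp] by (auto simp: soc_def)
      moreover have "pel w" unfolding pel_def using wp by (intro exI[of _ 1]) simp
      ultimately show ?thesis using f_pel[of w] wc w(2) by (auto simp: verts)
    qed
  qed
  also have "card (\<A> \<union> {P. subgroup P G \<and> card P = p}) = card \<A> + num_subgroups_of_order p G"
    unfolding num_subgroups_of_order_def
  proof (rule card_Un_disjoint)
    have "\<A> \<subseteq> Pow (carrier G)" using sub(1) subgroup.subset by blast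
    then show "finite \<A>" using fin finite_subset by blast
    have "{P. subgroup P G \<and> card P = p} \<subseteq> Pow (carrier G)" using subgroup.subset by blast
    then show "finite {P. subgroup P G \<and> card P = p}" using fin finite_subset by blast
    show "\<A> \<inter> {P. subgroup P G \<and> card P = p} = {}"
    proof (rule ccontr)
      assume "\<not> ?thesis"
      then obtain A where A: "A \<in> \<A>" "card A = p" by blast
      interpret A: group "G\<lparr>carrier := A\<rparr>" using sub(1)[OF A(1)] by (rule subgroup_imp_group)
      have "x = \<one>" if "x \<in> A" for x
        using no_p[OF A(1) that, of 1] A.pow_order_eq_1[of x] that A(2) by (simp add: order_def pow_carrier_update)
      then have "A = {\<one>}" using subgroup.one_closed[OF sub(1)[OF A(1)]] by blast
      then show False using sub(2) A(1) by blast
    qed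
  qed
  finally show ?thesis .
qed

end

section \<open>2-Frobenius groups\<close>

text \<open>Elements of \<open>K\<close> have \<open>p\<close>-power order, and the rest of
  \<open>L\<close> lies in conjugates of \<open>H\<close> by the definition of the kernel. For
  \<open>x\<close> outside \<open>L\<close>, the \<open>p ^ m\<close>-th power lies in
  \<open>L\<close>, so its coset is in the Frobenius kernel of \<open>G Mod K\<close> although that
  of \<open>x\<close> is not; hence this power lies in \<open>K\<close>, and its
  \<open>p ^ n\<close>-th power is trivial.\<close>

lemma (in group) p_element_or_mem_conj_complement:
  fixes p m n :: nat
  assumes KL: "K \<lhd> G" "L \<lhd> G" "K \<subseteq> L"
    and compl: "K = frobenius_kernel (G\<lparr>carrier := L\<rparr>) H"
    and T: "frobenius_complement (G Mod K) T"
    and N: "carrier (G\<lparr>carrier := L\<rparr> Mod K) = frobenius_kernel (G Mod K) T"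
      "carrier (G\<lparr>carrier := L\<rparr> Mod K) \<lhd> G Mod K"
    and card_K: "card K = p ^ n" and card_quot: "order (G Mod L) = p ^ m"
    and x: "x \<in> carrier G"
  shows "(\<exists>k. x [^] (p ^ k) = \<one>) \<or>
    (\<exists>g\<in>L. x \<in> g <#\<^bsub>G\<lparr>carrier := L\<rparr>\<^esub> (H #>\<^bsub>G\<lparr>carrier := L\<rparr>\<^esub> inv\<^bsub>G\<lparr>carrier := L\<rparr>\<^esub> g))"
proof -
  let ?N = "carrier (G\<lparr>carrier := L\<rparr> Mod K)"
  interpret Q: group "G Mod K" using KL(1) by (rule normal.factorgroup_is_group)
  interpret QL: group "G Mod L" using KL(2) by (rule normal.factorgroup_is_group)
  have Ksub: "subgroup K G" and Lsub: "subgroup L G" using KL(1,2) by (simp_all add: normal_imp_subgroup)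
  interpret K: group "G\<lparr>carrier := K\<rparr>" using Ksub by (rule subgroup_imp_group)
  have Kpow: "y [^] (p ^ n) = \<one>" if "y \<in> K" for y
    using K.pow_order_eq_1[of y] that card_K by (simp add: order_def pow_carrier_update)
  show ?thesis
  proof (cases "x \<in> L")
    case True
    show ?thesis
    proof (cases "x \<in> K")
      case False
      then show ?thesis
        using True unfolding compl frobenius_kernel_def by auto
    qed (use Kpow in blast)
  next
    case False
    let ?y = "x [^] (p ^ m)"
    have "L #> x \<in> carrier (G Mod L)" using x by (auto simp: carrier_FactGroup)
    then have "L #> ?y = L"
      using QL.pow_order_eq_1[of "L #> x"] normal.FactGroup_pow[OF KL(2) x, of "p ^ m"] card_quot by simp
    then have yL: "?y \<in> L"
      using rcos_self[OF _ Lsub, of ?y] x by simp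
    have N_iff: "K #> z \<in> ?N \<longleftrightarrow> z \<in> L" if z: "z \<in> carrier G" for z
    proof
      assume "K #> z \<in> ?N"
      then obtain l where l: "l \<in> L" "K #> z = K #> l" by (auto simp: carrier_FactGroup)
      then have "z \<in> K #> l" using rcos_self[OF z Ksub] by simp
      then obtain k where "k \<in> K" "z = k \<otimes> l" by (auto simp: r_coset_def)
      then show "z \<in> L" using subgroup.m_closed[OF Lsub] KL(3) l(1) by blast
    qed (auto simp: carrier_FactGroup)
    have C: "K #> x \<in> carrier (G Mod K)" using x by (auto simp: carrier_FactGroup)
    have pow: "(K #> x) [^]\<^bsub>G Mod K\<^esub> (p ^ m) = K #> ?y"
      using normal.FactGroup_pow[OF KL(1) x, of "p ^ m"] by simp
    have "K #> x \<notin> ?N" using N_iff[OF x] False by simp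
    moreover have "(K #> x) [^]\<^bsub>G Mod K\<^esub> (p ^ m) \<in> ?N"
      unfolding pow using N_iff[of ?y] yL x by simp
    ultimately have "(K #> x) [^]\<^bsub>G Mod K\<^esub> (p ^ m) = \<one>\<^bsub>G Mod K\<^esub>"
      by (rule Q.frobenius_complement_pow_in_kernel[OF T N C])
    then have "K #> ?y = K" using pow by simp
    then have "?y \<in> K" using rcos_self[OF _ Ksub, of ?y] x by simp
    then have "?y [^] (p ^ n) = \<one>" by (rule Kpow)
    then have "x [^] (p ^ (m + n)) = \<one>"
      using x by (simp add: nat_pow_pow power_add)
    then show ?thesis by blast
  qed
qed

lemma (in group) card_components_two_frobenius:
  fixes K L :: "'a set" and p :: nat
  assumes "finite (carrier G)"
    and "two_frobenius_group G K L"
    and "Factorial_Ring.prime p"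
    and "p_group p (G\<lparr>carrier := K\<rparr>)"
    and "p_group p (G Mod L)"
  shows "card (connected_components (cyclic_graph G)) = card K + num_subgroups_of_order p G"
proof -
  let ?L = "G\<lparr>carrier := L\<rparr>"
  let ?N = "carrier (?L Mod K)"
  have KL: "K \<lhd> G" "L \<lhd> G"
    and "frobenius_group_with_kernel ?L K" "frobenius_group_with_kernel (G Mod K) ?N"
    using assms(2) by (simp_all add: two_frobenius_group_def)
  then obtain H T where H: "frobenius_complement ?L H" "K = frobenius_kernel ?L H"
    and T: "frobenius_complement (G Mod K) T" "?N = frobenius_kernel (G Mod K) T"
    unfolding frobenius_group_with_kernel_def by blast
  obtain n where n: "card K = p ^ n" using assms(4) by (auto simp: p_group_def order_def)
  obtain m where m: "order (G Mod L) = p ^ m" using assms(5) by (auto simp: p_group_def)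
  have Ksub: "subgroup K G" and Lsub: "subgroup L G" using KL by (simp_all add: normal_imp_subgroup)
  interpret L: group ?L using Lsub by (rule subgroup_imp_group)
  have Lc: "g \<in> carrier G" if "g \<in> L" for g using that subgroup.mem_carrier[OF Lsub] by blast
  have "K \<subseteq> carrier ?L"
    unfolding H(2) frobenius_kernel_def using L.one_closed by blast
  then have KsubL: "K \<subseteq> L" by simp
  have K_normal: "K \<lhd> ?L" using normal_restrict_supergroup[OF Lsub KL(1) KsubL] .
  have finL: "finite (carrier ?L)" using subgroup.subset[OF Lsub] assms(1) finite_subset by auto
  interpret F: frobenius_p_kernel ?L H K p n
    by (intro frobenius_p_kernel.intro frobenius_p_kernel_axioms.intro L.is_group finL H K_normal assms(3) n)
  interpret Q: group "G Mod K" using KL(1) by (rule normal.factorgroup_is_group)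
  have N_normal: "?N \<lhd> G Mod K"
    using normality_factorization[OF KL(1) KsubL KL(2)] by (simp add: FactGroup_def)
  \<comment> \<open>Restricting \<open>G Mod K\<close> to the cosets in \<open>L\<close> gives the
    same structure as the quotient of \<open>L\<close>, so the automorphism induced by
    \<open>T\<close> lives on \<open>?L Mod K\<close>.\<close>
  have "(G Mod K)\<lparr>carrier := ?N\<rparr> = ?L Mod K"
    by (simp add: FactGroup_def set_mult_def fun_eq_iff)
  moreover have "finite (carrier (G Mod K))" using assms(1) by (simp add: carrier_FactGroup)
  ultimately obtain \<alpha> where "fpf_group (?L Mod K) \<alpha>"
    using Q.frobenius_kernel_fpf[OF _ T N_normal] F.rank_le_one_quotient by metis
  then obtain C where "C \<in> ?N" "?N = powers (?L Mod K) C"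
    using fpf_group_cyclic by blast
  then obtain h where h: "h \<in> H" "H = powers G h"
    using F.complement_cyclic by (auto simp: powers_carrier_update)
  have HL: "H \<subseteq> L" using subgroup.subset[OF F.H_subgroup] by simp
  have Hsub: "subgroup H G" using incl_subgroup[OF Lsub F.H_subgroup] .
  have Hc: "u \<in> carrier G" if "u \<in> H" for u using that HL Lc by blast
  let ?c = "\<lambda>g. g <#\<^bsub>?L\<^esub> (H #>\<^bsub>?L\<^esub> inv\<^bsub>?L\<^esub> g)"
  \<comment> \<open>Inverses in \<open>L\<close> and in \<open>G\<close> agree, so conjugates formed
    inside \<open>L\<close> can be handled in \<open>G\<close>, where the partition criterion is
    stated.\<close>
  have c: "?c g = (\<lambda>h. g \<otimes> h \<otimes> inv g) ` H" if "g \<in> L" for g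
    using L.conj_set_eq_image[of H g] HL that m_inv_consistent[OF Lsub that] by simp
  have "card (connected_components (cyclic_graph G)) = card (?c ` L) + num_subgroups_of_order p G"
  proof (rule card_components_cyclic_partition[OF assms(1,3)])
    fix A assume "A \<in> ?c ` L"
    then obtain g where g: "g \<in> L" "A = (\<lambda>h. g \<otimes> h \<otimes> inv g) ` H" using c by auto
    interpret conj: group_hom G G "\<lambda>h. g \<otimes> h \<otimes> inv g"
      by unfold_locales (rule conj_hom[OF Lc[OF g(1)]])
    show "subgroup A G"
      unfolding g(2) by (rule conj.subgroup_img_is_subgroup[OF Hsub])
    obtain u where "u \<in> H" "u \<noteq> \<one>"
      using H(1) subgroup.one_closed[OF Hsub] unfolding frobenius_complement_def by auto
    then have "g \<otimes> u \<otimes> inv g \<in> A" "g \<otimes> u \<otimes> inv g \<noteq> \<one>" using g Hc Lc by auto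
    then show "A \<noteq> {\<one>}" by blast
    have "A = powers G (g \<otimes> h \<otimes> inv g)"
      unfolding g(2) by (subst h(2)) (use g Lc h Hc in \<open>auto simp: powers_def conj_pow\<close>)
    then show "\<exists>h\<in>A. A = powers G h" using g(2) h(1) by blast
    fix x k assume x: "x \<in> A" "x [^] (p ^ k) = \<one>"
    then obtain v where v: "v \<in> H" "x = g \<otimes> v \<otimes> inv g" using g(2) by blast
    then have "v [^] (p ^ k) = \<one>" using x(2) conj_pow[OF Lc[OF g(1)] Hc] Lc[OF g(1)] Hc by simp
    then have "v = \<one>" using F.H_no_p_elements[OF v(1), of k] by (simp add: pow_carrier_update)
    then show "x = \<one>" using v(2) Lc[OF g(1)] by simp
  next
    fix A B x assume "A \<in> ?c ` L" "B \<in> ?c ` L" and x: "x \<in> A" "x \<in> B" "x \<noteq> \<one>"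
    then obtain g g' where g: "g \<in> L" "g' \<in> L" "A = ?c g" "B = ?c g'" by blast
    then have "inv\<^bsub>?L\<^esub> g \<otimes>\<^bsub>?L\<^esub> g' \<in> H"
      using L.frobenius_complement_conj_Int[OF H(1), of g g' x] x by simp
    then show "A = B"
      using L.conj_set_eqI[OF F.H_subgroup, of g g'] g by simp
  next
    fix x assume "x \<in> carrier G"
    then show "(\<exists>k. x [^] (p ^ k) = \<one>) \<or> (\<exists>A\<in>?c ` L. x \<in> A)"
      using p_element_or_mem_conj_complement[OF KL KsubL H(2) T N_normal n m] by blast
  qed
  \<comment> \<open>The kernel of a Frobenius group has as many elements as the complement has
    conjugates; this accounts for the summand \<open>card K\<close>.\<close>
  moreover have "card (?c ` L) = card K"
    using L.card_frobenius_kernel(1)[OF finL H(1)] H(2) by simp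
  ultimately show ?thesis by simp
qed

theorem theorem2:
  fixes G :: "('a, 'b) monoid_scheme" and K L :: "'a set" and p :: nat
  assumes "group G"
    and "finite (carrier G)"
    and "two_frobenius_group G K L"
    and "Factorial_Ring.prime p"
    and "p_group p (G\<lparr>carrier := K\<rparr>)"
    and "p_group p (G Mod L)"
  shows "card (connected_components (cyclic_graph G)) = card K + num_subgroups_of_order p G"
  using group.card_components_two_frobenius[OF assms] .

end
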